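(* Let $(R,\mathfrak{m})$ be a commutative local ring, let $I\subseteq\mathfrak{m}$ be an ideal of $R$, let $F$ be the minimal free resolution of $R/I$ over $R$ equipped with a multiplication giving it the structure of an MDG $R$-algebra, and let $r\in\mathfrak{m}$ be an $(R/I)$-regular element. Let $F+eF$ be the mapping cone MDG $R$-algebra described in the context. Let $\langle F+eF\rangle_{F}$ be the associator $F$-submodule of $F+eF$ (viewed as an MDG $F$-module) and let $\langle F+eF\rangle$ be the associator $(F+eF)$-ideal of $F+eF$ (viewed as an MDG algebra, i.e. as an MDG module over itself). Then $$\langle F+eF\rangle_{F}=\langle F\rangle+e\langle F\rangle=\langle F+eF\rangle.$$ In particular, $F+eF$ is an associative extension of $F$. More generally, suppose $\boldsymbol{r}=r_{1},\dots,r_{m}$ is a maximal $(R/I)$-regular sequence contained in $\mathfrak{m}$. Set $$F+\boldsymbol{e}F=F+\sum_{i=1}^{m}e_{i}F$$ to be the minimal $R$-free resolution of $R/\langle I,\boldsymbol{r}\rangle$ obtained by iterating the mapping cone construction, where $e_{i}$ is an exterior variable of degree $1$ which satisfies $\mathrm{d}e_{i}=r_{i}$, and where the multiplication of $F$ is extended to a multiplication on $F+\boldsymbol{e}F$ by extending it from $F+\sum_{i=1}^{k}e_{i}F$ to $F+\sum_{i=1}^{k+1}e_{i}F$ for each $1\leq k<m$ in the same way as it is extended from $F$ to $F+eF$. Then $$\langle F+\boldsymbol{e}F\rangle_{F}=\langle F\rangle+\boldsymbol{e}\langle F\rangle=\langle F+\boldsymbol{e}F\rangle,$$ where $\boldsymbol{e}\langle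 F\rangle:=\sum_{i=1}^{m}e_{i}\langle F\rangle$. In particular, $F+\boldsymbol{e}F$ is an associative extension of $F$.
   Context: An MDG $R$-algebra is an $R$-complex $A$ (differential $\mathrm{d}$ of degree $-1$) with a chain map $A\otimes_R A\to A$, $a_1\otimes a_2\mapsto a_1a_2$ (the multiplication), which is unital and strictly graded-commutative ($a_1a_2=(-1)^{|a_1||a_2|}a_2a_1$, and $a^2=0$ for $|a|$ odd), but not necessarily associative. An MDG $A$-module is an $R$-complex $X$ with a chain map $A\otimes_R X\to X$, $a\otimes x\mapsto ax$, with $1x=x$ (and $xa:=(-1)^{|a||x|}ax$). For an MDG $A$-module $X$, the associator $A$-submodule of $X$ is the smallest MDG $A$-submodule of $X$ (subcomplex closed under $A$-scalar multiplication) containing all associators $(a_1a_2)x-a_1(a_2x)$ with $a_1,a_2\in A$, $x\in X$; it is denoted $\langle X\rangle$. $\langle F\rangle$ denotes the associator submodule of $F$ over itself, and $\langle F+\boldsymbol{e}F\rangle_F$, $\langle F+\boldsymbol{e}F\rangle$ denote the associator submodules of $F+\boldsymbol{e}F$ as an MDG $F$-module and as an MDG module over itself, respectively. The mapping cone $F+eF$ is the minimal free resolution of $R/\langle I,r\rangle$ over $R$; here $e$ is thought of as an exterior variable of degree $1$, the differential is $\mathrm{d}(a+eb)=\mathrm{d}(a)+rb-e\,\mathrm{d}(b)$, and the multiplication of $F$ is extended to $F+eF$ by $(a+eb)(c+ed)=ac+e(bc+(-1)^{|a|}ad)$ for $a,b,c,d\in F$ ($a$ homogeneous in the sign). It is an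 MDG $F$-module via the inclusion $F\subseteq F+eF$. If $X$ is an MDG $A$-submodule of an MDG $A$-module $Y$, then $Y$ is called an associative extension of $X$ if $\langle X\rangle=X\cap\langle Y\rangle$.
   Formalization: For the iterated cone, F+eF and ⟨F⟩+e⟨F⟩ are read as sums over all exterior monomials, including products such as e_1e_2⟨F⟩, not only the linear terms e_i⟨F⟩; with linear terms only, the formula fails for m≥2 whenever ⟨F⟩ is nonzero. *)

theory Defs
  imports Complex_Main "HOL-Library.Function_Algebras" "HOL-Library.Set_Algebras"
begin

section \<open>Local rings and regular sequences\<close>

definition is_ideal :: "'r::comm_ring_1 set \<Rightarrow> bool" where
  "is_ideal I \<longleftrightarrow> module.subspace ((*) :: 'r \<Rightarrow> 'r \<Rightarrow> 'r) I"

definition ideal_gen :: "'r::comm_ring_1 set \<Rightarrow> 'r set" where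
  "ideal_gen S = module.span ((*) :: 'r \<Rightarrow> 'r \<Rightarrow> 'r) S"

definition is_maximal_ideal :: "'r::comm_ring_1 set \<Rightarrow> bool" where
  "is_maximal_ideal M \<longleftrightarrow> is_ideal M \<and> M \<noteq> UNIV \<and>
     (\<forall>J. is_ideal J \<longrightarrow> M \<subseteq> J \<longrightarrow> J = M \<or> J = UNIV)"

definition local_ring_with :: "'r::comm_ring_1 set \<Rightarrow> bool" where
  "local_ring_with \<mm> \<longleftrightarrow> is_maximal_ideal \<mm> \<and> (\<forall>M. is_maximal_ideal M \<longrightarrow> M = \<mm>)"

text \<open>
  \<open>r\<close> is \<open>R/J\<close>-regular: multiplication by \<open>r\<close> on \<open>R/J\<close> is injective. The nonvanishing
  \<open>(R/J)/r(R/J) \<noteq> 0\<close> is a separate condition in the definition of a regular sequence.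
\<close>
definition quot_regular :: "'r::comm_ring_1 set \<Rightarrow> 'r \<Rightarrow> bool" where
  "quot_regular J r \<longleftrightarrow> (\<forall>a. r * a \<in> J \<longrightarrow> a \<in> J)"

definition quot_regular_seq :: "'r::comm_ring_1 set \<Rightarrow> 'r list \<Rightarrow> bool" where
  "quot_regular_seq I rs \<longleftrightarrow>
     (\<forall>k<length rs. quot_regular (ideal_gen (I \<union> set (take k rs))) (rs ! k)) \<and>
     ideal_gen (I \<union> set rs) \<noteq> UNIV"

definition maximal_quot_regular_seq :: "'r::comm_ring_1 set \<Rightarrow> 'r set \<Rightarrow> 'r list \<Rightarrow> bool" where
  "maximal_quot_regular_seq \<mm> I rs \<longleftrightarrow>
     set rs \<subseteq> \<mm> \<and> quot_regular_seq I rs \<and> (\<forall>s\<in>\<mm>. \<not> quot_regular_seq I (rs @ [s]))"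


section \<open>Complexes of modules\<close>

text \<open>
  A complex is presented by one module: \<open>gr C i\<close> is the component of degree \<open>i\<close>, a
  submodule of an ambient module \<open>'x\<close>, and \<open>carr C\<close> is the (internal) direct sum of the
  components, which need not exhaust the type \<open>'x\<close>. The operations are unconstrained
  outside \<open>carr C\<close>.
\<close>
record ('r, 'x) r_complex =
  scl :: "'r \<Rightarrow> 'x \<Rightarrow> 'x"
  gr :: "int \<Rightarrow> 'x set"
  dif :: "'x \<Rightarrow> 'x"

definition carr :: "('r::comm_ring_1, 'x::ab_group_add, 'z) r_complex_scheme \<Rightarrow> 'x set" where
  "carr C = module.span (scl C) (\<Union>i. gr C i)"

definition is_complex :: "('r::comm_ring_1, 'x::ab_group_add, 'z) r_complex_scheme \<Rightarrow> bool" where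
  "is_complex C \<longleftrightarrow>
     module (scl C) \<and>
     (\<forall>i. module.subspace (scl C) (gr C i)) \<and>
     (\<forall>J f. finite J \<longrightarrow> (\<forall>i\<in>J. f i \<in> gr C i) \<longrightarrow> (\<Sum>i\<in>J. f i) = 0 \<longrightarrow> (\<forall>i\<in>J. f i = 0)) \<and>
     (\<forall>x\<in>carr C. \<forall>y\<in>carr C. dif C (x + y) = dif C x + dif C y) \<and>
     (\<forall>r. \<forall>x\<in>carr C. dif C (scl C r x) = scl C r (dif C x)) \<and>
     (\<forall>i. \<forall>x\<in>gr C i. dif C x \<in> gr C (i - 1)) \<and>
     (\<forall>x\<in>carr C. dif C (dif C x) = 0)"

text \<open>Subcomplexes are graded: they are spanned by their homogeneous elements.\<close>
definition is_subcomplex ::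
  "('r::comm_ring_1, 'x::ab_group_add, 'z) r_complex_scheme \<Rightarrow> 'x set \<Rightarrow> bool" where
  "is_subcomplex C N \<longleftrightarrow>
     N \<subseteq> carr C \<and> module.subspace (scl C) N \<and>
     N = module.span (scl C) (\<Union>i. N \<inter> gr C i) \<and>
     dif C ` N \<subseteq> N"

definition subcomplex ::
  "('r::comm_ring_1, 'x::ab_group_add, 'z) r_complex_scheme \<Rightarrow> 'x set \<Rightarrow> ('r, 'x) r_complex" where
  "subcomplex C N = \<lparr>scl = scl C, gr = (\<lambda>i. N \<inter> gr C i), dif = dif C\<rparr>"

definition is_free :: "('r::comm_ring_1 \<Rightarrow> 'x::ab_group_add \<Rightarrow> 'x) \<Rightarrow> 'x set \<Rightarrow> bool" where
  "is_free s M \<longleftrightarrow> (\<exists>B. \<not> module.dependent s B \<and> module.span s B = M)"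

text \<open>
  \<open>\<epsilon>\<close> is a surjective \<open>R\<close>-linear map from \<open>M\<close> onto \<open>R/I\<close> with kernel \<open>K\<close>. The elements of
  \<open>R/I\<close> are the cosets \<open>a +o I\<close>; their sum is the elementwise sum of sets, and
  \<open>r \<cdot> (a +o I) = r *o (a +o I) + I\<close>.
\<close>
definition epi_onto_quot ::
  "('r::comm_ring_1 \<Rightarrow> 'x::ab_group_add \<Rightarrow> 'x) \<Rightarrow> 'r set \<Rightarrow> 'x set \<Rightarrow> 'x set \<Rightarrow> ('x \<Rightarrow> 'r set) \<Rightarrow> bool"
where
  "epi_onto_quot s I M K \<epsilon> \<longleftrightarrow>
     \<epsilon> ` M = range (\<lambda>a. a +o I) \<and>
     (\<forall>x\<in>M. \<forall>y\<in>M. \<epsilon> (x + y) = \<epsilon> x + \<epsilon> y) \<and>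
     (\<forall>r. \<forall>x\<in>M. \<epsilon> (s r x) = r *o \<epsilon> x + I) \<and>
     {x \<in> M. \<epsilon> x = I} = K"

definition minimal_free_resolution ::
  "'r::comm_ring_1 set \<Rightarrow> 'r set \<Rightarrow> ('r, 'x::ab_group_add, 'z) r_complex_scheme \<Rightarrow> bool" where
  "minimal_free_resolution \<mm> I C \<longleftrightarrow>
     is_complex C \<and>
     (\<forall>i<0. gr C i = {0}) \<and>
     (\<forall>i. is_free (scl C) (gr C i)) \<and>
     (\<forall>i>0. {x \<in> gr C i. dif C x = 0} = dif C ` gr C (i + 1)) \<and>
     (\<exists>\<epsilon>. epi_onto_quot (scl C) I (gr C 0) (dif C ` gr C 1) \<epsilon>) \<and>
     dif C ` carr C \<subseteq> module.span (scl C) {scl C r x | r x. r \<in> \<mm> \<and> x \<in> carr C}"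


section \<open>MDG algebras and modules\<close>

definition ksign :: "int \<Rightarrow> 'x::ab_group_add \<Rightarrow> 'x" where
  "ksign i x = (if even i then x else - x)"

record ('r, 'x) mdg = "('r, 'x) r_complex" +
  mul :: "'x \<Rightarrow> 'x \<Rightarrow> 'x"
  one :: "'x"

text \<open>\<open>act\<close> is the bilinear form of a chain map \<open>A \<otimes>\<^sub>R X \<rightarrow> X\<close>.\<close>
definition chain_action ::
  "('r::comm_ring_1, 'a::ab_group_add, 'y) r_complex_scheme \<Rightarrow>
   ('r, 'x::ab_group_add, 'z) r_complex_scheme \<Rightarrow> ('a \<Rightarrow> 'x \<Rightarrow> 'x) \<Rightarrow> bool" where
  "chain_action A X act \<longleftrightarrow>
     (\<forall>a\<in>carr A. \<forall>b\<in>carr A. \<forall>x\<in>carr X. act (a + b) x = act a x + act b x) \<and>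
     (\<forall>a\<in>carr A. \<forall>x\<in>carr X. \<forall>y\<in>carr X. act a (x + y) = act a x + act a y) \<and>
     (\<forall>r. \<forall>a\<in>carr A. \<forall>x\<in>carr X.
        act (scl A r a) x = scl X r (act a x) \<and> act a (scl X r x) = scl X r (act a x)) \<and>
     (\<forall>i j. \<forall>a\<in>gr A i. \<forall>x\<in>gr X j.
        act a x \<in> gr X (i + j) \<and>
        dif X (act a x) = act (dif A a) x + ksign i (act a (dif X x)))"

definition mdg_algebra :: "('r::comm_ring_1, 'x::ab_group_add) mdg \<Rightarrow> bool" where
  "mdg_algebra A \<longleftrightarrow>
     is_complex A \<and> chain_action A A (mul A) \<and>
     one A \<in> gr A 0 \<and> (\<forall>a\<in>carr A. mul A (one A) a = a \<and> mul A a (one A) = a) \<and>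
     (\<forall>i j. \<forall>a\<in>gr A i. \<forall>b\<in>gr A j. mul A a b = ksign (i * j) (mul A b a)) \<and>
     (\<forall>i. odd i \<longrightarrow> (\<forall>a\<in>gr A i. mul A a a = 0))"

definition mdg_module ::
  "('r::comm_ring_1, 'a::ab_group_add) mdg \<Rightarrow>
   ('r, 'x::ab_group_add, 'z) r_complex_scheme \<Rightarrow> ('a \<Rightarrow> 'x \<Rightarrow> 'x) \<Rightarrow> bool" where
  "mdg_module A X act \<longleftrightarrow>
     mdg_algebra A \<and> is_complex X \<and> chain_action A X act \<and> (\<forall>x\<in>carr X. act (one A) x = x)"

definition mdg_submodule ::
  "('r::comm_ring_1, 'a::ab_group_add) mdg \<Rightarrow>
   ('r, 'x::ab_group_add, 'z) r_complex_scheme \<Rightarrow> ('a \<Rightarrow> 'x \<Rightarrow> 'x) \<Rightarrow> 'x set \<Rightarrow> bool" where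
  "mdg_submodule A X act N \<longleftrightarrow>
     is_subcomplex X N \<and> (\<forall>a\<in>carr A. \<forall>x\<in>N. act a x \<in> N)"

definition associator_submodule ::
  "('r::comm_ring_1, 'a::ab_group_add) mdg \<Rightarrow>
   ('r, 'x::ab_group_add, 'z) r_complex_scheme \<Rightarrow> ('a \<Rightarrow> 'x \<Rightarrow> 'x) \<Rightarrow> 'x set" where
  "associator_submodule A X act =
     \<Inter> {N. mdg_submodule A X act N \<and>
           (\<forall>a1\<in>carr A. \<forall>a2\<in>carr A. \<forall>x\<in>carr X.
              act (mul A a1 a2) x - act a1 (act a2 x) \<in> N)}"

abbreviation associator_ideal :: "('r::comm_ring_1, 'a::ab_group_add) mdg \<Rightarrow> 'a set" where
  "associator_ideal A \<equiv> associator_submodule A A (mul A)"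

definition associative_extension ::
  "('r::comm_ring_1, 'a::ab_group_add) mdg \<Rightarrow>
   ('r, 'x::ab_group_add, 'z) r_complex_scheme \<Rightarrow> ('a \<Rightarrow> 'x \<Rightarrow> 'x) \<Rightarrow> 'x set \<Rightarrow> bool" where
  "associative_extension A Y act X \<longleftrightarrow>
     mdg_module A Y act \<and> mdg_submodule A Y act X \<and>
     associator_submodule A (subcomplex Y X) act = X \<inter> associator_submodule A Y act"


section \<open>The iterated mapping cone\<close>

text \<open>
  To iterate \<open>F \<mapsto> F + eF\<close> inside one type, elements of the iterated cone are functions
  \<open>x :: nat set \<Rightarrow> 'f\<close>, where \<open>x S\<close> is the coefficient of \<open>e\<^sub>S = e\<^bsub>i\<^sub>p\<^esub> \<cdots> e\<^bsub>i\<^sub>1\<^esub>\<close> for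
  \<open>S = {i\<^sub>1 < \<cdots> < i\<^sub>p}\<close>; addition is pointwise. \<open>emon S a\<close> is \<open>e\<^sub>S a\<close>, so \<open>emon {}\<close> is the
  inclusion of \<open>F\<close>.
\<close>
definition emon :: "nat set \<Rightarrow> 'f::zero \<Rightarrow> nat set \<Rightarrow> 'f" where
  "emon S a = (\<lambda>T. if T = S then a else 0)"

text \<open>
  \<open>emul k b\<close> is \<open>e\<^sub>k b\<close> for \<open>b\<close> not involving \<open>e\<^sub>k\<close>; every \<open>x\<close> is uniquely \<open>a + e\<^sub>k b\<close> with \<open>a\<close>,
  \<open>b\<close> not involving \<open>e\<^sub>k\<close>, namely \<open>a = cone_fst k x\<close> and \<open>b = cone_snd k x\<close>.
\<close>
definition emul :: "nat \<Rightarrow> (nat set \<Rightarrow> 'f::zero) \<Rightarrow> nat set \<Rightarrow> 'f" where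
  "emul k b = (\<lambda>S. if k \<in> S then b (S - {k}) else 0)"

definition cone_fst :: "nat \<Rightarrow> (nat set \<Rightarrow> 'f::zero) \<Rightarrow> nat set \<Rightarrow> 'f" where
  "cone_fst k x = (\<lambda>S. if k \<in> S then 0 else x S)"

definition cone_snd :: "nat \<Rightarrow> (nat set \<Rightarrow> 'f::zero) \<Rightarrow> nat set \<Rightarrow> 'f" where
  "cone_snd k x = (\<lambda>S. if k \<in> S then 0 else x (insert k S))"

text \<open>The linear extension of \<open>a \<mapsto> (-1)\<^bsup>|a|\<^esup> a\<close> (\<open>a\<close> homogeneous) to all of \<open>carr A\<close>:
  write \<open>a = u + v\<close> with \<open>u\<close> of even and \<open>v\<close> of odd degrees.\<close>
definition parity_twist ::
  "('r::comm_ring_1, 'x::ab_group_add, 'z) r_complex_scheme \<Rightarrow> 'x \<Rightarrow> 'x" where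
  "parity_twist A a = (THE y. \<exists>u v.
     u \<in> module.span (scl A) (\<Union>i\<in>{i. even i}. gr A i) \<and>
     v \<in> module.span (scl A) (\<Union>i\<in>{i. odd i}. gr A i) \<and>
     a = u + v \<and> y = u - v)"

definition mapping_cone ::
  "nat \<Rightarrow> 'r::comm_ring_1 \<Rightarrow> ('r, nat set \<Rightarrow> 'f::ab_group_add) mdg \<Rightarrow> ('r, nat set \<Rightarrow> 'f) mdg" where
  "mapping_cone k r A =
     \<lparr>scl = scl A,
      gr = (\<lambda>i. {a + emul k b | a b. a \<in> gr A i \<and> b \<in> gr A (i - 1)}),
      dif = (\<lambda>x. let a = cone_fst k x; b = cone_snd k x
                 in dif A a + scl A r b - emul k (dif A b)),
      mul = (\<lambda>x y. let a = cone_fst k x; b = cone_snd k x; c = cone_fst k y; d = cone_snd k y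
                   in mul A a c + emul k (mul A b c + mul A (parity_twist A a) d)),
      one = one A\<rparr>"

text \<open>The copy of \<open>F\<close> inside \<open>nat set \<Rightarrow> 'f\<close>, with no exterior variables adjoined.\<close>
definition cone_base ::
  "('r::comm_ring_1, 'f::ab_group_add) mdg \<Rightarrow> ('r, nat set \<Rightarrow> 'f) mdg" where
  "cone_base F =
     \<lparr>scl = (\<lambda>r x S. scl F r (x S)),
      gr = (\<lambda>i. emon {} ` gr F i),
      dif = (\<lambda>x. emon {} (dif F (x {}))),
      mul = (\<lambda>x y. emon {} (mul F (x {}) (y {}))),
      one = emon {} (one F)\<rparr>"

text \<open>
  \<open>cone_tower F rs k\<close> has \<open>e\<^sub>0, \<dots>, e\<^bsub>k-1\<^esub>\<close> adjoined, with \<open>d e\<^sub>i = rs ! i\<close>.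
\<close>
primrec cone_tower ::
  "('r::comm_ring_1, 'f::ab_group_add) mdg \<Rightarrow> 'r list \<Rightarrow> nat \<Rightarrow> ('r, nat set \<Rightarrow> 'f) mdg" where
  "cone_tower F rs 0 = cone_base F"
| "cone_tower F rs (Suc k) = mapping_cone k (rs ! k) (cone_tower F rs k)"

definition iterated_cone ::
  "('r::comm_ring_1, 'f::ab_group_add) mdg \<Rightarrow> 'r list \<Rightarrow> ('r, nat set \<Rightarrow> 'f) mdg" where
  "iterated_cone F rs = cone_tower F rs (length rs)"

text \<open>The action of \<open>F\<close> on a cone through the inclusion of \<open>F\<close>.\<close>
definition base_act ::
  "('r, nat set \<Rightarrow> 'f::ab_group_add) mdg \<Rightarrow> 'f \<Rightarrow> (nat set \<Rightarrow> 'f) \<Rightarrow> nat set \<Rightarrow> 'f" where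
  "base_act Y a y = mul Y (emon {} a) y"

text \<open>
  For \<open>N \<subseteq> F\<close> and \<open>m\<close> exterior variables, \<open>N + \<^bold>eN = \<Sum>\<^sub>S e\<^sub>S N\<close> with \<open>S\<close> ranging over all
  subsets of \<open>{0, \<dots>, m-1}\<close>: as the iterated cone itself, written \<open>F + \<^bold>eF\<close>, contains the
  products of the \<open>e\<^sub>i\<close>, the notation covers these as well. It is what results from iterating
  \<open>N \<mapsto> N + e\<^sub>k N\<close>.
\<close>
definition e_span :: "nat \<Rightarrow> 'f::ab_group_add set \<Rightarrow> (nat set \<Rightarrow> 'f) set" where
  "e_span m N = {\<Sum>S\<in>Pow {..<m}. emon S (x S) | x. \<forall>S\<in>Pow {..<m}. x S \<in> N}"

end

theory Submission
  imports Defs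
begin

text \<open>
  Write \<open>\<sigma>\<close> for the linear extension of \<open>a \<mapsto> (-1)\<^sup>|\<^sup>a\<^sup>| a\<close>; it is multiplicative because the
  multiplication adds degrees. With \<open>[a, b, c] = (ab)c - a(bc)\<close>, the associator of \<open>a + eb\<close>, \<open>c + ed\<close>,
  \<open>u + ev\<close> is \<open>[a, c, u] + e([b, c, u] + [\<sigma>a, d, u] + [\<sigma>a, \<sigma>c, v])\<close>, and \<open>\<langle>A\<rangle> + e\<langle>A\<rangle>\<close> is an ideal of
  \<open>A + eA\<close>, so it contains \<open>\<langle>A + eA\<rangle>\<close>. Conversely, let \<open>N\<close> be an \<open>F\<close>-submodule of \<open>A + eA\<close> containing
  the associators. Then \<open>{n \<in> N \<inter> A. en \<in> N}\<close> is an \<open>F\<close>-submodule of \<open>A\<close>, since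
  \<open>e d(n) = rn - d(en)\<close> and \<open>a(en) = e(\<sigma>(a)n)\<close>, and it contains the associators of \<open>A\<close>, so
  \<open>\<langle>A\<rangle>\<^sub>F + e\<langle>A\<rangle>\<^sub>F \<subseteq> \<langle>A + eA\<rangle>\<^sub>F\<close>. Iterating both inclusions gives
  \<open>\<langle>F\<rangle> + \<^bold>e\<langle>F\<rangle> \<subseteq> \<langle>F + \<^bold>eF\<rangle>\<^sub>F \<subseteq> \<langle>F + \<^bold>eF\<rangle> \<subseteq> \<langle>F\<rangle> + \<^bold>e\<langle>F\<rangle>\<close>.
\<close>

section \<open>Graded submodules and the parity twist\<close>

locale chain_complex =
  fixes C :: "('r::comm_ring_1, 'x::ab_group_add, 'z) r_complex_scheme"
  assumes is_complex: "is_complex C"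
begin

sublocale module "scl C"
  using is_complex by (simp add: is_complex_def)

lemma gr_subspace: "subspace (gr C i)"
  using is_complex by (simp add: is_complex_def)

lemma gr_independent:
  "finite J \<Longrightarrow> (\<And>i. i \<in> J \<Longrightarrow> f i \<in> gr C i) \<Longrightarrow> (\<Sum>i\<in>J. f i) = 0 \<Longrightarrow> i \<in> J \<Longrightarrow> f i = 0"
  using is_complex unfolding is_complex_def by metis

lemma dif_add: "x \<in> carr C \<Longrightarrow> y \<in> carr C \<Longrightarrow> dif C (x + y) = dif C x + dif C y"
  and dif_scale: "x \<in> carr C \<Longrightarrow> dif C (scl C r x) = scl C r (dif C x)"
  and dif_gr: "x \<in> gr C i \<Longrightarrow> dif C x \<in> gr C (i - 1)"
  and dif_dif: "x \<in> carr C \<Longrightarrow> dif C (dif C x) = 0"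
  using is_complex unfolding is_complex_def by blast+

lemma gr_carr: "x \<in> gr C i \<Longrightarrow> x \<in> carr C"
  unfolding carr_def by (intro span_base) blast

lemma carr_subspace: "subspace (carr C)"
  unfolding carr_def by (rule subspace_span)

lemma zero_carr: "0 \<in> carr C"
  using carr_subspace by (rule subspace_0)

lemma add_carr: "x \<in> carr C \<Longrightarrow> y \<in> carr C \<Longrightarrow> x + y \<in> carr C"
  using carr_subspace by (rule subspace_add)

lemma diff_carr: "x \<in> carr C \<Longrightarrow> y \<in> carr C \<Longrightarrow> x - y \<in> carr C"
  using carr_subspace by (rule subspace_diff)

lemma scale_carr: "x \<in> carr C \<Longrightarrow> scl C r x \<in> carr C"
  using carr_subspace by (rule subspace_scale)

lemma dif_zero [simp]: "dif C 0 = 0"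
  using dif_add[OF zero_carr zero_carr] by simp

lemma dif_minus: "x \<in> carr C \<Longrightarrow> dif C (- x) = - dif C x"
  using dif_scale[of x "-1"] by simp

lemma dif_diff: "x \<in> carr C \<Longrightarrow> y \<in> carr C \<Longrightarrow> dif C (x - y) = dif C x - dif C y"
  using dif_add[of x "- y"] dif_minus[of y] subspace_neg[OF carr_subspace, of y] by simp

text \<open>Each \<open>V i\<close> is a subspace, so the terms of a linear combination that share
  an index can be merged, which leaves one term per index.\<close>

lemma span_UN_sum:
  assumes "x \<in> span (\<Union>i\<in>K. V i)" and V: "\<And>i. i \<in> K \<Longrightarrow> subspace (V i)"
  obtains J f where "finite J" "J \<subseteq> K" "\<And>i. i \<in> J \<Longrightarrow> f i \<in> V i" "x = (\<Sum>i\<in>J. f i)"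
proof -
  have "\<exists>J f. finite J \<and> J \<subseteq> K \<and> (\<forall>i\<in>J. f i \<in> V i) \<and> x = (\<Sum>i\<in>J. f i)"
    using assms(1)
  proof (induction rule: span_induct_alt)
    case base
    then show ?case by (intro exI[of _ "{}"]) simp
  next
    case (step c x y)
    then obtain i J f where i: "i \<in> K" "x \<in> V i"
      and J: "finite J" "J \<subseteq> K" "\<And>j. j \<in> J \<Longrightarrow> f j \<in> V j" "y = (\<Sum>j\<in>J. f j)"
      by blast
    \<comment> \<open>Extending \<open>f\<close> by zero treats an index \<open>i\<close> that
      already occurs in \<open>J\<close> and a new one alike; the term \<open>scl C c x\<close> is
      then added at \<open>i\<close>.\<close>
    let ?g = "\<lambda>j. if j \<in> J then f j else 0"
    let ?h = "?g(i := ?g i + scl C c x)"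
    have "(\<Sum>j\<in>insert i J. ?h j) = ?g i + scl C c x + (\<Sum>j\<in>J - {i}. ?g j)"
      using J(1) by (subst sum.insert_remove) (auto intro!: sum.cong)
    also have "y = ?g i + (\<Sum>j\<in>J - {i}. ?g j)"
      using J(1,4) by (cases "i \<in> J") (auto simp: sum.remove intro: sum.cong)
    then have "?g i + scl C c x + (\<Sum>j\<in>J - {i}. ?g j) = scl C c x + y"
      by (simp only: ac_simps)
    finally have "scl C c x + y = (\<Sum>j\<in>insert i J. ?h j)" by simp
    moreover have "?h j \<in> V j" if "j \<in> insert i J" for j
      using that i J(2,3) V by (auto intro!: subspace_add subspace_scale intro: subspace_0)
    ultimately show ?case
      using J(1,2) i(1) by (intro exI[of _ "insert i J"] exI[of _ ?h]) auto
  qed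
  then show thesis using that by blast
qed

lemma carr_sum:
  assumes "x \<in> carr C"
  obtains J f where "finite J" "\<And>i. i \<in> J \<Longrightarrow> f i \<in> gr C i" "x = (\<Sum>i\<in>J. f i)"
  using span_UN_sum[of x "gr C" UNIV] assms gr_subspace unfolding carr_def by metis

text \<open>Scalars need no case of their own: a multiple of a homogeneous element is homogeneous of
  the same degree. Additive claims about \<open>carr C\<close> thus reduce to homogeneous
  elements.\<close>

lemma carr_induct [consumes 1, case_names zero hom add]:
  assumes "x \<in> carr C" and "P 0" and hom: "\<And>i x. x \<in> gr C i \<Longrightarrow> P x"
    and add: "\<And>x y. x \<in> carr C \<Longrightarrow> y \<in> carr C \<Longrightarrow> P x \<Longrightarrow> P y \<Longrightarrow> P (x + y)"
  shows "P x"
proof -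
  \<comment> \<open>Membership is carried through the induction because the premise
    \<open>add\<close> asks for it.\<close>
  have "x \<in> carr C \<and> P x"
    using assms(1) unfolding carr_def[of C]
  proof (induction rule: span_induct_alt)
    case (step c x y)
    then obtain i where "x \<in> gr C i" by blast
    then have "scl C c x \<in> gr C i" using gr_subspace subspace_scale by blast
    then have "scl C c x \<in> carr C" "P (scl C c x)" using hom gr_carr by blast+
    then show ?case using step add add_carr unfolding carr_def by blast
  qed (simp add: assms(2) span_zero)
  then show ?thesis by blast
qed

lemma dif_carr: "x \<in> carr C \<Longrightarrow> dif C x \<in> carr C"
  by (induction rule: carr_induct) (auto simp: zero_carr dif_add intro: add_carr gr_carr dif_gr)

text \<open>Both families are extended by zero to \<open>J \<union> J'\<close>; their difference is
  then a relation between homogeneous elements of distinct degrees.\<close>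

lemma sum_unique:
  assumes J: "finite J" "\<And>i. i \<in> J \<Longrightarrow> f i \<in> gr C i"
    and J': "finite J'" "\<And>i. i \<in> J' \<Longrightarrow> g i \<in> gr C i"
    and eq: "(\<Sum>i\<in>J. f i) = (\<Sum>i\<in>J'. g i)"
  shows "(if i \<in> J then f i else 0) = (if i \<in> J' then g i else 0)"
proof (cases "i \<in> J \<union> J'")
  case True
  let ?f = "\<lambda>i. if i \<in> J then f i else 0" and ?g = "\<lambda>i. if i \<in> J' then g i else 0"
  have "(\<Sum>i\<in>J \<union> J'. ?f i) = (\<Sum>i\<in>J. f i)" "(\<Sum>i\<in>J \<union> J'. ?g i) = (\<Sum>i\<in>J'. g i)"
    using J J' by (intro sum.mono_neutral_cong_right; auto)+
  then have "(\<Sum>i\<in>J \<union> J'. ?f i - ?g i) = 0" using eq by (simp add: sum_subtractf)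
  then have "?f i - ?g i = 0"
    by (rule gr_independent[rotated 2])
      (use J J' True in \<open>auto intro!: subspace_diff[OF gr_subspace] subspace_neg[OF gr_subspace]
        subspace_0[OF gr_subspace]\<close>)
  then show ?thesis by simp
qed auto

text \<open>An element whose homogeneous components lie in \<open>N\<close> is in the span of the
  homogeneous elements of \<open>N\<close>. Gradedness in this form passes readily to intersections
  and preimages.\<close>

lemma is_subcomplexI:
  assumes "N \<subseteq> carr C" "subspace N"
    and N: "\<And>J f i. finite J \<Longrightarrow> (\<And>i. i \<in> J \<Longrightarrow> f i \<in> gr C i) \<Longrightarrow> (\<Sum>i\<in>J. f i) \<in> N
      \<Longrightarrow> i \<in> J \<Longrightarrow> f i \<in> N"
    and "\<And>x. x \<in> N \<Longrightarrow> dif C x \<in> N"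
  shows "is_subcomplex C N"
proof -
  have "x \<in> span (\<Union>i. N \<inter> gr C i)" if "x \<in> N" for x
  proof -
    obtain J f where J: "finite J" "\<And>i. i \<in> J \<Longrightarrow> f i \<in> gr C i" "x = (\<Sum>i\<in>J. f i)"
      using carr_sum assms(1) \<open>x \<in> N\<close> by blast
    then have "f i \<in> N" if "i \<in> J" for i using N[of J f i] that \<open>x \<in> N\<close> by blast
    then show ?thesis unfolding J(3) using J(2) by (intro span_sum span_base) blast
  qed
  moreover have "span (\<Union>i. N \<inter> gr C i) \<subseteq> N" using assms(2) by (intro span_minimal) auto
  ultimately show ?thesis using assms unfolding is_subcomplex_def by blast
qed

text \<open>The element also has an expression with all terms in \<open>N\<close>, and uniqueness of
  components identifies the two.\<close>

lemma subcomplex_component: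
  assumes "is_subcomplex C N" and J: "finite J" "\<And>i. i \<in> J \<Longrightarrow> f i \<in> gr C i"
    and "(\<Sum>i\<in>J. f i) \<in> N" and "i \<in> J"
  shows "f i \<in> N"
proof -
  have N: "subspace N" and "N = span (\<Union>i. N \<inter> gr C i)"
    using assms(1) unfolding is_subcomplex_def by blast+
  then have "(\<Sum>i\<in>J. f i) \<in> span (\<Union>i\<in>UNIV. N \<inter> gr C i)" using assms(4) by simp
  then obtain J' g where J': "finite J'" "\<And>i. i \<in> J' \<Longrightarrow> g i \<in> N \<inter> gr C i"
      "(\<Sum>i\<in>J. f i) = (\<Sum>i\<in>J'. g i)"
    using N gr_subspace by (elim span_UN_sum) (auto intro: subspace_inter)
  have "f i = (if i \<in> J' then g i else 0)"
    using sum_unique[of J f J' g i] J J' assms(5) by auto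
  then show ?thesis using J'(2) N subspace_0 by (cases "i \<in> J'") auto
qed

lemma sum_shift: "(\<Sum>i\<in>J. f i) = (\<Sum>j\<in>(\<lambda>i. i + c) ` J. f (j - c))" for c :: int
  by (subst sum.reindex) (auto simp: inj_on_def)

text \<open>Multiplication by an exterior variable shifts degrees by one, so families also occur
  whose index differs from their degree by a constant \<open>c\<close>. Reindexing by
  \<open>i + c\<close> reduces them to the unshifted case.\<close>

lemma gr_independent_shift:
  assumes "finite J" "\<And>i. i \<in> J \<Longrightarrow> f i \<in> gr C (i + c)" "(\<Sum>i\<in>J. f i) = 0" "i \<in> J"
  shows "f i = 0"
proof -
  have "f ((i + c) - c) = 0"
    by (rule gr_independent[of "(\<lambda>i. i + c) ` J" "\<lambda>j. f (j - c)"])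
      (use assms in \<open>auto simp: sum_shift[symmetric]\<close>)
  then show ?thesis by simp
qed

lemma subcomplex_component_shift:
  assumes "is_subcomplex C N" "finite J" "\<And>i. i \<in> J \<Longrightarrow> f i \<in> gr C (i + c)"
    "(\<Sum>i\<in>J. f i) \<in> N" "i \<in> J"
  shows "f i \<in> N"
proof -
  have "f ((i + c) - c) \<in> N"
    by (rule subcomplex_component[OF assms(1), of "(\<lambda>i. i + c) ` J" "\<lambda>j. f (j - c)"])
      (use assms in \<open>auto simp: sum_shift[symmetric]\<close>)
  then show ?thesis by simp
qed

lemma subcomplex_subspace: "is_subcomplex C N \<Longrightarrow> subspace N"
  and subcomplex_carr: "is_subcomplex C N \<Longrightarrow> x \<in> N \<Longrightarrow> x \<in> carr C"
  and subcomplex_dif: "is_subcomplex C N \<Longrightarrow> x \<in> N \<Longrightarrow> dif C x \<in> N"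
  unfolding is_subcomplex_def by blast+

lemma subspace_ksign: "subspace V \<Longrightarrow> x \<in> V \<Longrightarrow> ksign i x \<in> V"
  by (auto simp: ksign_def subspace_neg)

text \<open>The description by \<open>THE\<close> is well defined: two decompositions differ by an
  element that is a sum of even-degree elements and also a sum of odd-degree elements. Independence
  of the degrees makes it zero.\<close>

lemma parity_twist_diff:
  assumes "u \<in> span (\<Union>i\<in>{i. even i}. gr C i)" "v \<in> span (\<Union>i\<in>{i. odd i}. gr C i)"
  shows "parity_twist C (u + v) = u - v"
proof -
  have "u' = u \<and> v' = v"
    if "u' \<in> span (\<Union>i\<in>{i. even i}. gr C i)" "v' \<in> span (\<Union>i\<in>{i. odd i}. gr C i)"
      "u + v = u' + v'" for u' v'
  proof -
    have "u - u' \<in> span (\<Union>i\<in>{i. even i}. gr C i)" "v' - v \<in> span (\<Union>i\<in>{i. odd i}. gr C i)"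
      using assms that by (auto intro: span_diff)
    then obtain J f J' g where J: "finite J" "J \<subseteq> {i. even i}" "\<And>i. i \<in> J \<Longrightarrow> f i \<in> gr C i"
        "u - u' = (\<Sum>i\<in>J. f i)"
      and J': "finite J'" "J' \<subseteq> {i. odd i}" "\<And>i. i \<in> J' \<Longrightarrow> g i \<in> gr C i"
        "v' - v = (\<Sum>i\<in>J'. g i)"
      using gr_subspace by (elim span_UN_sum) metis+
    have eq: "u - u' = v' - v" using that(3) by (simp add: algebra_simps)
    \<comment> \<open>The index sets \<open>J\<close> and \<open>J'\<close> are disjoint by parity,
      so the component of the other sum in degree \<open>i\<close> is zero.\<close>
    have "f i = 0" if "i \<in> J" for i
      using sum_unique[of J f J' g i] J J' eq that by auto
    then have "u - u' = 0" using J(4) by simp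
    then show ?thesis using that(3) by simp
  qed
  then show ?thesis unfolding parity_twist_def using assms by (intro the_equality) blast+
qed

text \<open>Grouping the terms by the parity of their degree turns the decomposition
  \<open>u + v\<close> into the sign rule; additivity and stability of graded submodules follow from
  this formula.\<close>

lemma parity_twist_sum:
  assumes J: "finite J" "\<And>i. i \<in> J \<Longrightarrow> f i \<in> gr C i"
  shows "parity_twist C (\<Sum>i\<in>J. f i) = (\<Sum>i\<in>J. ksign i (f i))"
proof -
  let ?E = "{i \<in> J. even i}" and ?O = "{i \<in> J. odd i}"
  have *: "(\<Sum>i\<in>J. h i) = (\<Sum>i\<in>?E. h i) + (\<Sum>i\<in>?O. h i)" for h :: "int \<Rightarrow> 'x"
    using J(1) by (subst sum.union_disjoint[symmetric]) (auto intro!: sum.cong)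
  have "parity_twist C ((\<Sum>i\<in>?E. f i) + (\<Sum>i\<in>?O. f i)) = (\<Sum>i\<in>?E. f i) - (\<Sum>i\<in>?O. f i)"
    by (rule parity_twist_diff) (use J in \<open>auto intro!: span_sum intro: span_base\<close>)
  then show ?thesis
    unfolding *[of f] *[of "\<lambda>i. ksign i (f i)"] by (simp add: ksign_def sum_negf)
qed

lemma parity_twist_hom: "x \<in> gr C i \<Longrightarrow> parity_twist C x = ksign i x"
  using parity_twist_sum[of "{i}" "\<lambda>_. x"] by simp

lemma parity_twist_zero [simp]: "parity_twist C 0 = 0"
  using parity_twist_sum[of "{}"] by simp

lemma parity_twist_add:
  assumes "x \<in> carr C" "y \<in> carr C"
  shows "parity_twist C (x + y) = parity_twist C x + parity_twist C y"
proof -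
  obtain J f where J: "finite J" "\<And>i. i \<in> J \<Longrightarrow> f i \<in> gr C i" "x = (\<Sum>i\<in>J. f i)"
    using carr_sum assms(1) by blast
  obtain J' g where J': "finite J'" "\<And>i. i \<in> J' \<Longrightarrow> g i \<in> gr C i" "y = (\<Sum>i\<in>J'. g i)"
    using carr_sum assms(2) by blast
  let ?f = "\<lambda>i. if i \<in> J then f i else 0" and ?g = "\<lambda>i. if i \<in> J' then g i else 0"
  have xy: "x = (\<Sum>i\<in>J \<union> J'. ?f i)" "y = (\<Sum>i\<in>J \<union> J'. ?g i)"
    using J J' by (auto intro!: sum.mono_neutral_cong_left)
  have fg: "?f i \<in> gr C i" "?g i \<in> gr C i" for i
    using J J' subspace_0[OF gr_subspace] by auto
  have fin: "finite (J \<union> J')" using J J' by simp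
  have "x + y = (\<Sum>i\<in>J \<union> J'. ?f i + ?g i)" using xy by (simp add: sum.distrib)
  then have "parity_twist C (x + y) = (\<Sum>i\<in>J \<union> J'. ksign i (?f i + ?g i))"
    using parity_twist_sum[OF fin, of "\<lambda>i. ?f i + ?g i"] fg subspace_add[OF gr_subspace] by simp
  also have "\<dots> = (\<Sum>i\<in>J \<union> J'. ksign i (?f i)) + (\<Sum>i\<in>J \<union> J'. ksign i (?g i))"
    unfolding sum.distrib[symmetric] by (intro sum.cong refl) (simp add: ksign_def)
  also have "\<dots> = parity_twist C x + parity_twist C y"
    unfolding xy parity_twist_sum[OF fin fg(1)] parity_twist_sum[OF fin fg(2)] ..
  finally show ?thesis .
qed

lemma parity_twist_scale:
  assumes "x \<in> carr C"
  shows "parity_twist C (scl C c x) = scl C c (parity_twist C x)"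
  using assms
proof (induction rule: carr_induct)
  case (hom i x)
  then have "scl C c x \<in> gr C i" using gr_subspace subspace_scale by blast
  then show ?case using hom by (simp add: parity_twist_hom ksign_def)
qed (simp_all add: parity_twist_add scale_carr scale_right_distrib)

text \<open>A graded submodule contains the components of its elements, hence also their signed
  sum.\<close>

lemma parity_twist_subcomplex:
  assumes "is_subcomplex C N" "x \<in> N"
  shows "parity_twist C x \<in> N"
proof -
  obtain J f where J: "finite J" "\<And>i. i \<in> J \<Longrightarrow> f i \<in> gr C i" "x = (\<Sum>i\<in>J. f i)"
    using carr_sum subcomplex_carr assms by blast
  then show ?thesis
    using parity_twist_sum[of J f] subcomplex_component[of N J f] assms subcomplex_subspace[of N]
    by (auto intro!: subspace_sum subspace_ksign)
qed

lemma is_subcomplex_carr: "is_subcomplex C (carr C)"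
  by (rule is_subcomplexI) (auto intro: carr_subspace gr_carr dif_carr)

lemma parity_twist_carr: "x \<in> carr C \<Longrightarrow> parity_twist C x \<in> carr C"
  using parity_twist_subcomplex is_subcomplex_carr by blast

lemma parity_twist_gr: "x \<in> gr C i \<Longrightarrow> parity_twist C x \<in> gr C i"
  using parity_twist_hom subspace_ksign gr_subspace by metis

lemma parity_twist_twist: "x \<in> carr C \<Longrightarrow> parity_twist C (parity_twist C x) = x"
proof (induction rule: carr_induct)
  case (hom i x)
  then show ?case using parity_twist_hom parity_twist_gr by (metis add.inverse_inverse ksign_def)
qed (simp_all add: parity_twist_add parity_twist_carr)

end

section \<open>Chain actions of one complex on another\<close>

locale chain_act = A: chain_complex A + X: chain_complex X
  for A :: "('r::comm_ring_1, 'a::ab_group_add) mdg"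
    and X :: "('r, 'x::ab_group_add, 'z) r_complex_scheme" +
  fixes act :: "'a \<Rightarrow> 'x \<Rightarrow> 'x"
  assumes chain_action: "chain_action A X act"
begin

lemma act_add_left:
    "a \<in> carr A \<Longrightarrow> b \<in> carr A \<Longrightarrow> x \<in> carr X \<Longrightarrow> act (a + b) x = act a x + act b x"
  and act_add_right:
    "a \<in> carr A \<Longrightarrow> x \<in> carr X \<Longrightarrow> y \<in> carr X \<Longrightarrow> act a (x + y) = act a x + act a y"
  and act_scale_left: "a \<in> carr A \<Longrightarrow> x \<in> carr X \<Longrightarrow> act (scl A r a) x = scl X r (act a x)"
  and act_scale_right: "a \<in> carr A \<Longrightarrow> x \<in> carr X \<Longrightarrow> act a (scl X r x) = scl X r (act a x)"
  and act_gr: "a \<in> gr A i \<Longrightarrow> x \<in> gr X j \<Longrightarrow> act a x \<in> gr X (i + j)"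
  and leibniz: "a \<in> gr A i \<Longrightarrow> x \<in> gr X j \<Longrightarrow>
    dif X (act a x) = act (dif A a) x + ksign i (act a (dif X x))"
  using chain_action unfolding chain_action_def by blast+

lemma act_zero_left: "x \<in> carr X \<Longrightarrow> act 0 x = 0"
  using act_add_left[of 0 0 x] A.zero_carr by simp

lemma act_zero_right: "a \<in> carr A \<Longrightarrow> act a 0 = 0"
  using act_add_right[of a 0 0] X.zero_carr by simp

lemma act_minus_left: "a \<in> carr A \<Longrightarrow> x \<in> carr X \<Longrightarrow> act (- a) x = - act a x"
  using act_scale_left[of a x "-1"] by simp

lemma act_minus_right: "a \<in> carr A \<Longrightarrow> x \<in> carr X \<Longrightarrow> act a (- x) = - act a x"
  using act_scale_right[of a x "-1"] by simp

lemma act_diff_left: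
  "a \<in> carr A \<Longrightarrow> b \<in> carr A \<Longrightarrow> x \<in> carr X \<Longrightarrow> act (a - b) x = act a x - act b x"
  using act_add_left[of "a - b" b x] A.diff_carr by simp

lemma act_diff_right:
  "a \<in> carr A \<Longrightarrow> x \<in> carr X \<Longrightarrow> y \<in> carr X \<Longrightarrow> act a (x - y) = act a x - act a y"
  using act_add_right[of a "x - y" y] X.diff_carr by simp

lemma act_carr:
  assumes "a \<in> carr A" "x \<in> carr X"
  shows "act a x \<in> carr X"
  using assms
proof (induction rule: A.carr_induct)
  case (hom i a)
  from hom(2) show ?case
    by (induction rule: X.carr_induct)
      (use hom(1) in \<open>auto simp: act_zero_right act_add_right A.gr_carr X.zero_carr
        intro: X.gr_carr X.add_carr act_gr\<close>)
qed (auto simp: act_zero_left act_add_left X.zero_carr intro: X.add_carr)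

text \<open>Degrees add under the action and (-1)^(i+j) = (-1)^i (-1)^j; biadditivity extends this
  from homogeneous elements. For an algebra acting on itself it says that the twist is
  multiplicative.\<close>

lemma parity_twist_act:
  assumes "a \<in> carr A" "x \<in> carr X"
  shows "parity_twist X (act a x) = act (parity_twist A a) (parity_twist X x)"
  using assms
proof (induction rule: A.carr_induct)
  case (hom i a)
  note a = hom(1)
  from hom(2) show ?case
  proof (induction rule: X.carr_induct)
    case (hom j x)
    then show ?case
      using a act_gr[OF a hom]
      by (auto simp: X.parity_twist_hom A.parity_twist_hom ksign_def act_minus_left
          act_minus_right A.gr_carr X.gr_carr A.subspace_neg[OF A.carr_subspace]
          X.subspace_neg[OF X.carr_subspace])
  qed (use a in \<open>simp_all add: act_zero_right A.gr_carr A.parity_twist_carr act_add_right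
      X.parity_twist_add X.parity_twist_carr act_carr\<close>)
qed (simp_all add: act_zero_left X.parity_twist_carr act_add_left A.parity_twist_add
    A.parity_twist_carr act_carr X.parity_twist_add)

lemma mdg_submodule_carr: "mdg_submodule A X act (carr X)"
  unfolding mdg_submodule_def using X.is_subcomplex_carr act_carr by blast

lemma associator_submodule_least:
  assumes "mdg_submodule A X act N"
    and "\<And>a b x. a \<in> carr A \<Longrightarrow> b \<in> carr A \<Longrightarrow> x \<in> carr X \<Longrightarrow> act (mul A a b) x - act a (act b x) \<in> N"
  shows "associator_submodule A X act \<subseteq> N"
  using assms unfolding associator_submodule_def by blast

end

section \<open>Associator submodules and their functoriality\<close>

locale mdg_act = chain_act A X act + mul: chain_act A A "mul A"
  for A :: "('r::comm_ring_1, 'a::ab_group_add) mdg"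
    and X :: "('r, 'x::ab_group_add, 'z) r_complex_scheme" and act
begin

lemma mdg_submodule_associator: "mdg_submodule A X act (associator_submodule A X act)"
proof -
  let ?S = "{N. mdg_submodule A X act N \<and> (\<forall>a\<in>carr A. \<forall>b\<in>carr A. \<forall>x\<in>carr X.
    act (mul A a b) x - act a (act b x) \<in> N)}"
  \<comment> \<open>This keeps the intersection inside \<open>carr X\<close>; an empty family would
    have the whole type as its intersection.\<close>
  have ne: "carr X \<in> ?S"
    using mdg_submodule_carr by (auto intro!: X.diff_carr act_carr mul.act_carr)
  have sub: "is_subcomplex X N" if "N \<in> ?S" for N using that by (auto simp: mdg_submodule_def)
  have "is_subcomplex X (\<Inter>?S)"
  proof (rule X.is_subcomplexI)
    show "\<Inter>?S \<subseteq> carr X" using ne by blast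
    show "X.subspace (\<Inter>?S)"
      by (rule X.subspace_Inter) (use sub X.subcomplex_subspace in blast)
    show "f i \<in> \<Inter>?S" if "finite J" "\<And>i. i \<in> J \<Longrightarrow> f i \<in> gr X i" "(\<Sum>i\<in>J. f i) \<in> \<Inter>?S" "i \<in> J"
      for J f i
      using X.subcomplex_component[OF sub that(1,2) _ that(4)] that(3) by blast
    show "dif X x \<in> \<Inter>?S" if "x \<in> \<Inter>?S" for x
      using X.subcomplex_dif[OF sub] that by blast
  qed
  moreover have "act a x \<in> \<Inter>?S" if "a \<in> carr A" "x \<in> \<Inter>?S" for a x
    using that by (auto simp: mdg_submodule_def)
  ultimately show ?thesis unfolding associator_submodule_def mdg_submodule_def by blast
qed

lemma associator_mem:
  "a \<in> carr A \<Longrightarrow> b \<in> carr A \<Longrightarrow> x \<in> carr X \<Longrightarrow>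
    act (mul A a b) x - act a (act b x) \<in> associator_submodule A X act"
  unfolding associator_submodule_def by blast

text \<open>The preimage of the target associator submodule under \<phi> is a submodule, and it
  contains the associators because \<phi> and \<psi> carry associators to associators. Inclusions,
  restriction of scalars and evaluation at \<open>{}\<close> are all instances.\<close>

lemma associator_submodule_image:
  fixes A' :: "('r, 'a'::ab_group_add) mdg" and X' :: "('r, 'x'::ab_group_add, 'z') r_complex_scheme"
  assumes "mdg_act A' X' act'"
    and \<psi>: "\<And>a. a \<in> carr A \<Longrightarrow> \<psi> a \<in> carr A'"
      "\<And>a b. a \<in> carr A \<Longrightarrow> b \<in> carr A \<Longrightarrow> \<psi> (mul A a b) = mul A' (\<psi> a) (\<psi> b)"
    and \<phi>: "\<And>i x. x \<in> gr X i \<Longrightarrow> \<phi> x \<in> gr X' i"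
      "\<And>x y. x \<in> carr X \<Longrightarrow> y \<in> carr X \<Longrightarrow> \<phi> (x + y) = \<phi> x + \<phi> y"
      "\<And>r x. x \<in> carr X \<Longrightarrow> \<phi> (scl X r x) = scl X' r (\<phi> x)"
      "\<And>x. x \<in> carr X \<Longrightarrow> \<phi> (dif X x) = dif X' (\<phi> x)"
      "\<And>a x. a \<in> carr A \<Longrightarrow> x \<in> carr X \<Longrightarrow> \<phi> (act a x) = act' (\<psi> a) (\<phi> x)"
  shows "\<phi> ` associator_submodule A X act \<subseteq> associator_submodule A' X' act'"
proof -
  interpret T: mdg_act A' X' act' by fact
  let ?N = "associator_submodule A' X' act'"
  let ?M = "{x \<in> carr X. \<phi> x \<in> ?N}"
  have N: "is_subcomplex X' ?N" "\<And>a x. a \<in> carr A' \<Longrightarrow> x \<in> ?N \<Longrightarrow> act' a x \<in> ?N"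
    using T.mdg_submodule_associator unfolding mdg_submodule_def by blast+
  note sN = T.X.subcomplex_subspace[OF N(1)]
  have \<phi>0: "\<phi> 0 = 0" using \<phi>(2)[OF X.zero_carr X.zero_carr] by simp
  have \<phi>m: "\<phi> (x - y) = \<phi> x - \<phi> y" if "x \<in> carr X" "y \<in> carr X" for x y
    using \<phi>(2)[of "x - y" y] that X.diff_carr by simp
  have \<phi>c: "\<phi> x \<in> carr X'" if "x \<in> carr X" for x
    using that by (induction rule: X.carr_induct)
      (auto simp: \<phi>0 \<phi>(2) T.X.zero_carr intro: T.X.add_carr T.X.gr_carr \<phi>(1))
  have \<phi>s: "\<phi> (\<Sum>i\<in>J. f i) = (\<Sum>i\<in>J. \<phi> (f i))" if "finite J" "\<And>i. i \<in> J \<Longrightarrow> f i \<in> carr X"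
    for J and f :: "int \<Rightarrow> 'x"
    using that
  proof (induction rule: finite_induct)
    case (insert j J)
    then have "(\<Sum>i\<in>J. f i) \<in> carr X" by (intro X.subspace_sum[OF X.carr_subspace]) simp
    then show ?case using insert \<phi>(2) by simp
  qed (simp add: \<phi>0)
  have "associator_submodule A X act \<subseteq> ?M"
  proof (rule associator_submodule_least)
    have "is_subcomplex X ?M"
    proof (rule X.is_subcomplexI)
      show "X.subspace ?M"
        by (rule X.subspaceI)
          (auto simp: \<phi>0 \<phi>(2,3) X.zero_carr intro: X.add_carr X.scale_carr
            T.X.subspace_0 T.X.subspace_add T.X.subspace_scale sN)
      show "f i \<in> ?M" if "finite J" "\<And>i. i \<in> J \<Longrightarrow> f i \<in> gr X i" "(\<Sum>i\<in>J. f i) \<in> ?M" "i \<in> J"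
        for J f i
      proof -
        have "(\<Sum>i\<in>J. \<phi> (f i)) \<in> ?N"
          using \<phi>s[of J f] that X.gr_carr by (metis (no_types, lifting) mem_Collect_eq)
        then have "\<phi> (f i) \<in> ?N"
          using T.X.subcomplex_component[OF N(1), of J "\<lambda>i. \<phi> (f i)" i] that \<phi>(1) by blast
        then show ?thesis using that X.gr_carr by blast
      qed
      show "dif X x \<in> ?M" if "x \<in> ?M" for x
        using that X.dif_carr T.X.subcomplex_dif[OF N(1)] \<phi>(4) by auto
    qed auto
    then show "mdg_submodule A X act ?M"
      unfolding mdg_submodule_def using act_carr N(2) \<phi>(5) \<psi>(1) by auto
    show "act (mul A a b) x - act a (act b x) \<in> ?M"
      if "a \<in> carr A" "b \<in> carr A" "x \<in> carr X" for a b x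
      using that T.associator_mem[of "\<psi> a" "\<psi> b" "\<phi> x"]
      by (auto simp: \<phi>m \<phi>(5) \<psi> \<phi>c act_carr mul.act_carr intro: X.diff_carr)
  qed
  then show ?thesis by blast
qed

end

section \<open>The mapping cone of one element\<close>

lemmas fun_arith = plus_fun_apply zero_fun_apply uminus_apply minus_apply
text \<open>Induction leaves eta-expanded functions behind, into which these rules would rewrite.\<close>
declare fun_arith [simp del]

section \<open>Linearity of the coordinates of \<open>a + e_k b\<close>\<close>

lemma emul_add: "emul k (a + b) = emul k a + emul k (b :: nat set \<Rightarrow> 'f::ab_group_add)"
  and emul_minus: "emul k (- a) = - emul k (a :: nat set \<Rightarrow> 'f::ab_group_add)"
  and emul_diff: "emul k (a - b) = emul k a - emul k (b :: nat set \<Rightarrow> 'f::ab_group_add)"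
  and emul_zero: "emul k 0 = (0 :: nat set \<Rightarrow> 'f::ab_group_add)"
  by (auto simp: emul_def fun_eq_iff fun_arith)

lemma emul_sum: "emul k (\<Sum>i\<in>J. f i) = (\<Sum>i\<in>J. emul k (f i :: nat set \<Rightarrow> 'f::ab_group_add))"
  by (induction J rule: infinite_finite_induct) (simp_all add: emul_zero emul_add)

lemma cone_fst_add:
    "cone_fst k (a + b) = cone_fst k a + cone_fst k (b :: nat set \<Rightarrow> 'f::ab_group_add)"
  and cone_fst_zero: "cone_fst k 0 = (0 :: nat set \<Rightarrow> 'f::ab_group_add)"
  by (auto simp: cone_fst_def fun_eq_iff fun_arith)

lemma cone_fst_sum:
  "cone_fst k (\<Sum>i\<in>J. f i) = (\<Sum>i\<in>J. cone_fst k (f i :: nat set \<Rightarrow> 'f::ab_group_add))"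
  by (induction J rule: infinite_finite_induct) (simp_all add: cone_fst_zero cone_fst_add)

lemma cone_snd_add:
    "cone_snd k (a + b) = cone_snd k a + cone_snd k (b :: nat set \<Rightarrow> 'f::ab_group_add)"
  and cone_snd_zero: "cone_snd k 0 = (0 :: nat set \<Rightarrow> 'f::ab_group_add)"
  by (auto simp: cone_snd_def fun_eq_iff fun_arith)

lemma cone_snd_sum:
  "cone_snd k (\<Sum>i\<in>J. f i) = (\<Sum>i\<in>J. cone_snd k (f i :: nat set \<Rightarrow> 'f::ab_group_add))"
  by (induction J rule: infinite_finite_induct) (simp_all add: cone_snd_zero cone_snd_add)

text \<open>The set \<open>V + e_k W\<close>. The two arguments differ for homogeneous components,
  where the degrees are \<open>i\<close> and \<open>i - 1\<close>; they agree for carriers and for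
  submodules \<open>N + e_k N\<close>.\<close>

definition cone_sum :: "nat \<Rightarrow> (nat set \<Rightarrow> 'f::ab_group_add) set \<Rightarrow> (nat set \<Rightarrow> 'f) set
    \<Rightarrow> (nat set \<Rightarrow> 'f) set" where
  "cone_sum k V W = {a + emul k b | a b. a \<in> V \<and> b \<in> W}"

lemma cone_sumI: "a \<in> V \<Longrightarrow> b \<in> W \<Longrightarrow> a + emul k b \<in> cone_sum k V W"
  unfolding cone_sum_def by blast

lemma cone_sumE:
  assumes "x \<in> cone_sum k V W"
  obtains a b where "a \<in> V" "b \<in> W" "x = a + emul k b"
  using assms unfolding cone_sum_def by blast

text \<open>The invariants of the iteration. By \<open>support\<close> only variables with index
  below \<open>k\<close> occur, so \<open>e_k\<close> is new and the coordinates of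
  \<open>a + e_k b\<close> are unique. The \<open>emon\<close> conditions embed \<open>F\<close>
  compatibly with products and differentials, with degrees both preserved and reflected.\<close>

locale cone_stage = F: chain_act F F "mul F" + A: chain_act A A "mul A"
  for F :: "('r::comm_ring_1, 'f::ab_group_add) mdg"
    and A :: "('r, nat set \<Rightarrow> 'f) mdg" +
  fixes k :: nat
  assumes one_F: "one F \<in> gr F 0"
    and scl_A: "scl A = (\<lambda>r x S. scl F r (x S))"
    and support: "x \<in> carr A \<Longrightarrow> x S \<noteq> 0 \<Longrightarrow> S \<subseteq> {..<k}"
    and emon_gr: "a \<in> gr F i \<Longrightarrow> emon {} a \<in> gr A i"
    and emon_gr_iff: "a \<in> carr F \<Longrightarrow> emon {} a \<in> gr A i \<Longrightarrow> a \<in> gr F i"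
    and emon_mul: "a \<in> carr F \<Longrightarrow> b \<in> carr F \<Longrightarrow> mul A (emon {} a) (emon {} b) = emon {} (mul F a b)"
    and emon_dif: "a \<in> carr F \<Longrightarrow> dif A (emon {} a) = emon {} (dif F a)"
    and one_A: "one A = emon {} (one F)"
    and one_mul: "x \<in> carr A \<Longrightarrow> mul A (one A) x = x"
begin

lemma free: "a \<in> carr A \<Longrightarrow> k \<in> S \<Longrightarrow> a S = 0"
  using support by blast

lemma cone_fst_pair [simp]:
  "a \<in> carr A \<Longrightarrow> cone_fst k (a + emul k b) = a"
  by (auto simp: cone_fst_def emul_def fun_eq_iff free fun_arith)

lemma cone_snd_pair [simp]:
  "a \<in> carr A \<Longrightarrow> b \<in> carr A \<Longrightarrow> cone_snd k (a + emul k b) = b"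
  by (auto simp: cone_snd_def emul_def fun_eq_iff free fun_arith)

lemma emul_scl: "emul k (scl A r b) = scl A r (emul k b)"
  by (auto simp: scl_A emul_def fun_eq_iff)

lemma emon_add: "emon {} (a + b) = emon {} a + emon {} (b :: 'f)"
  by (auto simp: emon_def fun_arith)

lemma emon_minus: "emon {} (- a) = - emon {} (a :: 'f)"
  by (auto simp: emon_def fun_arith)

lemma emon_zero: "emon {} 0 = (0 :: nat set \<Rightarrow> 'f)"
  by (auto simp: emon_def fun_arith)

lemma emon_scl: "emon {} (scl F r a) = scl A r (emon {} a)"
  by (auto simp: emon_def scl_A)

lemma emon_carr: "a \<in> carr F \<Longrightarrow> emon {} a \<in> carr A"
  by (induction rule: F.A.carr_induct)
    (auto simp: emon_zero emon_add A.A.zero_carr intro: A.A.add_carr A.A.gr_carr emon_gr)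

lemma emon_parity_twist: "a \<in> carr F \<Longrightarrow> parity_twist A (emon {} a) = emon {} (parity_twist F a)"
proof (induction rule: F.A.carr_induct)
  case (hom i a)
  then show ?case
    using A.A.parity_twist_hom[OF emon_gr[OF hom]] F.A.parity_twist_hom[OF hom]
    by (simp add: ksign_def emon_minus)
qed (simp_all add: emon_zero emon_add A.A.parity_twist_add F.A.parity_twist_add emon_carr)

end

locale cone_step = cone_stage F A k
  for F :: "('r::comm_ring_1, 'f::ab_group_add) mdg"
    and A :: "('r, nat set \<Rightarrow> 'f) mdg" and k +
  fixes r :: 'r
begin

abbreviation "Y \<equiv> mapping_cone k r A"

lemma cone_simps:
  "scl Y = scl A" "gr Y i = cone_sum k (gr A i) (gr A (i - 1))" "one Y = one A"
  by (simp_all add: mapping_cone_def cone_sum_def)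

lemma dif_cone:
  "a \<in> carr A \<Longrightarrow> b \<in> carr A \<Longrightarrow>
    dif Y (a + emul k b) = dif A a + scl A r b - emul k (dif A b)"
  by (simp add: mapping_cone_def)

lemma mul_cone:
  "a \<in> carr A \<Longrightarrow> b \<in> carr A \<Longrightarrow> c \<in> carr A \<Longrightarrow> d \<in> carr A \<Longrightarrow>
    mul Y (a + emul k b) (c + emul k d) =
      mul A a c + emul k (mul A b c + mul A (parity_twist A a) d)"
  by (simp add: mapping_cone_def)

lemma subspace_cone_sum:
  assumes "A.A.subspace V" "A.A.subspace W"
  shows "A.A.subspace (cone_sum k V W)"
proof (rule A.A.subspaceI)
  show "0 \<in> cone_sum k V W"
    using cone_sumI[OF A.A.subspace_0 A.A.subspace_0, OF assms, of k] by (simp add: emul_zero)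
next
  fix x y assume "x \<in> cone_sum k V W" "y \<in> cone_sum k V W"
  then obtain a b c d where *: "a \<in> V" "b \<in> W" "c \<in> V" "d \<in> W"
      and xy: "x = a + emul k b" "y = c + emul k d"
    by (auto elim!: cone_sumE)
  have "x + y = (a + c) + emul k (b + d)" unfolding xy by (simp add: emul_add)
  then show "x + y \<in> cone_sum k V W"
    using * assms by (auto intro: cone_sumI A.A.subspace_add)
next
  fix c x assume "x \<in> cone_sum k V W"
  then obtain a b where *: "a \<in> V" "b \<in> W" and x: "x = a + emul k b"
    by (auto elim!: cone_sumE)
  have "scl A c x = scl A c a + emul k (scl A c b)"
    unfolding x by (simp add: A.A.scale_right_distrib emul_scl)
  then show "scl A c x \<in> cone_sum k V W"
    using * assms by (auto intro: cone_sumI A.A.subspace_scale)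
qed

lemma gr_pair_left: "a \<in> gr A i \<Longrightarrow> a \<in> gr Y i"
  using cone_sumI[of a "gr A i" 0 "gr A (i - 1)" k] A.A.subspace_0[OF A.A.gr_subspace]
  by (simp add: cone_simps emul_zero)

lemma gr_pair_right: "b \<in> gr A i \<Longrightarrow> emul k b \<in> gr Y (i + 1)"
  using cone_sumI[of 0 "gr A (i + 1)" b "gr A i" k] A.A.subspace_0[OF A.A.gr_subspace]
  by (simp add: cone_simps)

lemma carr_cone: "carr Y = cone_sum k (carr A) (carr A)"
proof
  show "carr Y \<subseteq> cone_sum k (carr A) (carr A)"
    unfolding carr_def[of Y] cone_simps(1)
    by (rule A.A.span_minimal)
      (auto simp: cone_simps A.A.gr_carr A.A.carr_subspace
        intro!: subspace_cone_sum elim!: cone_sumE intro: cone_sumI)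
  have sub: "A.A.subspace (carr Y)"
    unfolding carr_def[of Y] cone_simps(1) by (rule A.A.subspace_span)
  have gr: "x \<in> carr Y" if "x \<in> gr Y i" for x i
    unfolding carr_def[of Y] cone_simps(1) using that by (intro A.A.span_base) blast
  have "a \<in> carr Y" if "a \<in> carr A" for a
    using that by (induction rule: A.A.carr_induct)
      (use gr gr_pair_left in \<open>auto intro: A.A.subspace_0[OF sub] A.A.subspace_add[OF sub]\<close>)
  moreover have "emul k b \<in> carr Y" if "b \<in> carr A" for b
    using that by (induction rule: A.A.carr_induct)
      (use gr gr_pair_right in \<open>auto simp: emul_zero emul_add
        intro: A.A.subspace_0[OF sub] A.A.subspace_add[OF sub]\<close>)
  ultimately show "cone_sum k (carr A) (carr A) \<subseteq> carr Y"
    by (auto elim!: cone_sumE intro: A.A.subspace_add[OF sub])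
qed

lemma gr_cone_fst: "x \<in> gr Y i \<Longrightarrow> cone_fst k x \<in> gr A i"
  and gr_cone_snd: "x \<in> gr Y i \<Longrightarrow> cone_snd k x \<in> gr A (i - 1)"
  and gr_cone_eq: "x \<in> gr Y i \<Longrightarrow> x = cone_fst k x + emul k (cone_snd k x)"
  unfolding cone_simps by (auto elim!: cone_sumE simp: A.A.gr_carr)

text \<open>The differential squares to zero because the two terms \<open>r d(b)\<close> cancel: one
  comes from \<open>d(rb)\<close>, the other from the coefficient \<open>- d(b)\<close> of the new
  variable.\<close>

lemma is_complex_cone: "is_complex Y"
proof (unfold is_complex_def, intro conjI allI impI ballI)
  show "module (scl Y)" by (simp add: cone_simps A.A.module_axioms)
  show "module.subspace (scl Y) (gr Y i)" for i
    unfolding cone_simps by (intro subspace_cone_sum A.A.gr_subspace)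
  show "f i = 0"
    if J: "finite J" "\<forall>i\<in>J. f i \<in> gr Y i" "(\<Sum>i\<in>J. f i) = 0" "i \<in> J" for J f i
  proof -
    \<comment> \<open>A relation in the cone holds in each coordinate; the second coordinates have
      degree one less than their index, hence the shift by -1.\<close>
    have "(\<Sum>i\<in>J. cone_fst k (f i)) = 0" "(\<Sum>i\<in>J. cone_snd k (f i)) = 0"
      using J(3) by (simp_all add: cone_fst_sum[symmetric] cone_snd_sum[symmetric]
          cone_fst_zero cone_snd_zero)
    then have "cone_fst k (f i) = 0" "cone_snd k (f i) = 0"
      using A.A.gr_independent[of J "\<lambda>i. cone_fst k (f i)" i] gr_cone_fst
        A.A.gr_independent_shift[of J "\<lambda>i. cone_snd k (f i)" "-1" i] gr_cone_snd J
      by auto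
    then show ?thesis using gr_cone_eq J by (metis add_0 emul_zero)
  qed
  show "dif Y (x + y) = dif Y x + dif Y y" if "x \<in> carr Y" "y \<in> carr Y" for x y
  proof -
    obtain a b c d where *: "a \<in> carr A" "b \<in> carr A" "c \<in> carr A" "d \<in> carr A"
        and xy: "x = a + emul k b" "y = c + emul k d"
      using \<open>x \<in> carr Y\<close> \<open>y \<in> carr Y\<close> unfolding carr_cone by (auto elim!: cone_sumE)
    have add: "(a + emul k b) + (c + emul k d) = (a + c) + emul k (b + d)" by (simp add: emul_add)
    show ?thesis
      using * unfolding xy add
      by (simp add: dif_cone A.A.dif_add A.A.add_carr A.A.scale_right_distrib)
        (simp add: emul_add)
  qed
  show "dif Y (scl Y c x) = scl Y c (dif Y x)" if "x \<in> carr Y" for c x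
  proof -
    obtain a b where *: "a \<in> carr A" "b \<in> carr A" and x: "x = a + emul k b"
      using \<open>x \<in> carr Y\<close> unfolding carr_cone by (auto elim!: cone_sumE)
    have scale: "scl A c (a + emul k b) = scl A c a + emul k (scl A c b)"
      by (simp add: A.A.scale_right_distrib emul_scl)
    show ?thesis
      using * unfolding x cone_simps scale
      by (simp add: dif_cone A.A.dif_scale A.A.scale_carr)
        (simp add: A.A.scale_right_distrib A.A.scale_right_diff_distrib emul_scl mult.commute)
  qed
  show "dif Y x \<in> gr Y (i - 1)" if "x \<in> gr Y i" for x i
  proof -
    obtain a b where *: "a \<in> gr A i" "b \<in> gr A (i - 1)" and x: "x = a + emul k b"
      using \<open>x \<in> gr Y i\<close> unfolding cone_simps by (auto elim!: cone_sumE)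
    have "dif Y x = (dif A a + scl A r b) + emul k (- dif A b)"
      using * unfolding x by (simp add: dif_cone A.A.gr_carr emul_minus)
    moreover have "dif A a + scl A r b \<in> gr A (i - 1)"
      using * by (intro A.A.subspace_add[OF A.A.gr_subspace] A.A.subspace_scale[OF A.A.gr_subspace]
          A.A.dif_gr)
    moreover have "- dif A b \<in> gr A (i - 1 - 1)"
      using * by (intro A.A.subspace_neg[OF A.A.gr_subspace] A.A.dif_gr)
    ultimately show ?thesis unfolding cone_simps by (auto intro: cone_sumI)
  qed
  show "dif Y (dif Y x) = 0" if "x \<in> carr Y" for x
  proof -
    obtain a b where *: "a \<in> carr A" "b \<in> carr A" and x: "x = a + emul k b"
      using \<open>x \<in> carr Y\<close> unfolding carr_cone by (auto elim!: cone_sumE)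
    have "dif Y x = (dif A a + scl A r b) + emul k (- dif A b)"
      using * unfolding x by (simp add: dif_cone emul_minus)
    moreover have "dif A a + scl A r b \<in> carr A" "- dif A b \<in> carr A"
      using * A.A.carr_subspace
      by (auto intro: A.A.add_carr A.A.scale_carr A.A.dif_carr A.A.subspace_neg)
    ultimately show ?thesis
      using * by (simp add: dif_cone A.A.dif_add A.A.dif_scale A.A.dif_dif A.A.dif_minus
          A.A.dif_carr A.A.scale_carr emul_zero)
  qed
qed

sublocale Y: chain_complex Y
  by unfold_locales (rule is_complex_cone)

lemma chain_action_cone: "chain_action Y Y (mul Y)"
proof (unfold chain_action_def, intro conjI allI impI ballI)
  note carr = A.A.add_carr A.A.scale_carr A.act_carr A.A.parity_twist_carr A.A.dif_carr
  note bilinear = A.act_add_left A.act_add_right A.act_scale_left A.act_scale_right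
  have pairE: thesis if "x \<in> carr Y" "\<And>a b. a \<in> carr A \<Longrightarrow> b \<in> carr A \<Longrightarrow> x = a + emul k b \<Longrightarrow> thesis"
    for x thesis
    using that unfolding carr_cone by (auto elim!: cone_sumE)
  have add: "(a + emul k b) + (c + emul k d) = (a + c) + emul k (b + d)" for a b c d :: "nat set \<Rightarrow> 'f"
    by (simp add: emul_add)
  have scale: "scl A s (a + emul k b) = scl A s a + emul k (scl A s b)" for s a b
    by (simp add: A.A.scale_right_distrib emul_scl)
  show "mul Y (x + y) z = mul Y x z + mul Y y z" "mul Y z (x + y) = mul Y z x + mul Y z y"
    if xyz: "x \<in> carr Y" "y \<in> carr Y" "z \<in> carr Y" for x y z
  proof -
    obtain a b where *: "a \<in> carr A" "b \<in> carr A" "x = a + emul k b" using xyz(1) by (rule pairE)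
    obtain c d where **: "c \<in> carr A" "d \<in> carr A" "y = c + emul k d" using xyz(2) by (rule pairE)
    obtain u v where ***: "u \<in> carr A" "v \<in> carr A" "z = u + emul k v" using xyz(3) by (rule pairE)
    show "mul Y (x + y) z = mul Y x z + mul Y y z" "mul Y z (x + y) = mul Y z x + mul Y z y"
      using *(1,2) **(1,2) ***(1,2) unfolding *(3) **(3) ***(3) add
      by (simp_all add: mul_cone carr bilinear A.A.parity_twist_add)
        (simp_all add: emul_add ac_simps)
  qed
  show "mul Y (scl Y s x) y = scl Y s (mul Y x y)" "mul Y x (scl Y s y) = scl Y s (mul Y x y)"
    if xy: "x \<in> carr Y" "y \<in> carr Y" for s x y
  proof -
    obtain a b where *: "a \<in> carr A" "b \<in> carr A" "x = a + emul k b" using xy(1) by (rule pairE)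
    obtain c d where **: "c \<in> carr A" "d \<in> carr A" "y = c + emul k d" using xy(2) by (rule pairE)
    show "mul Y (scl Y s x) y = scl Y s (mul Y x y)" "mul Y x (scl Y s y) = scl Y s (mul Y x y)"
      using *(1,2) **(1,2) unfolding *(3) **(3) cone_simps scale
      by (simp_all add: mul_cone carr bilinear A.A.parity_twist_scale)
        (simp_all add: A.A.scale_right_distrib emul_scl emul_add)
  qed
  show "mul Y x y \<in> gr Y (i + j)"
    "dif Y (mul Y x y) = mul Y (dif Y x) y + ksign i (mul Y x (dif Y y))"
    if xy: "x \<in> gr Y i" "y \<in> gr Y j" for x y i j
  proof -
    obtain a b where ab: "a \<in> gr A i" "b \<in> gr A (i - 1)" "x = a + emul k b"
      using xy(1) unfolding cone_simps by (rule cone_sumE)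
    obtain c d where cd: "c \<in> gr A j" "d \<in> gr A (j - 1)" "y = c + emul k d"
      using xy(2) unfolding cone_simps by (rule cone_sumE)
    note c = ab(1,2)[THEN A.A.gr_carr] cd(1,2)[THEN A.A.gr_carr]
    have dx: "dif Y x = (dif A a + scl A r b) + emul k (- dif A b)"
      using c unfolding ab by (simp add: dif_cone emul_minus)
    have dy: "dif Y y = (dif A c + scl A r d) + emul k (- dif A d)"
      using c unfolding cd by (simp add: dif_cone emul_minus)
    have neg: "- u \<in> carr A" if "u \<in> carr A" for u
      using that A.A.carr_subspace by (rule A.A.subspace_neg[rotated])
    \<comment> \<open>Lying in degree \<open>i - 1\<close>, this element is twisted by the sign
      opposite to (-1)^i. That sign makes the two terms \<open>r b d\<close> in the coefficient of
      \<open>e_k\<close> cancel.\<close>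
    have "dif A a + scl A r b \<in> gr A (i - 1)"
      using ab by (intro A.A.subspace_add[OF A.A.gr_subspace] A.A.subspace_scale[OF A.A.gr_subspace]
          A.A.dif_gr)
    then have twist: "parity_twist A (dif A a + scl A r b) = - ksign i (dif A a + scl A r b)"
      by (simp add: A.A.parity_twist_hom ksign_def)
    have "mul A a c \<in> gr A (i + j)" "mul A b c \<in> gr A (i + j - 1)" "mul A a d \<in> gr A (i + j - 1)"
      using A.act_gr[of a i c j] A.act_gr[of b "i - 1" c j] A.act_gr[of a i d "j - 1"] ab cd
      by (simp_all add: algebra_simps)
    then show "mul Y x y \<in> gr Y (i + j)"
      using c unfolding ab(3) cd(3) cone_simps
      by (auto simp: mul_cone A.A.parity_twist_hom[OF ab(1)] ksign_def A.act_minus_left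
          intro!: cone_sumI A.A.subspace_add[OF A.A.gr_subspace] A.A.subspace_diff[OF A.A.gr_subspace])
    \<comment> \<open>Once the parity of \<open>i\<close> is fixed every twist is a sign, and both
      coordinates follow from the Leibniz rule in \<open>A\<close> for the products
      \<open>ac\<close>, \<open>bc\<close> and \<open>ad\<close>.\<close>
    show "dif Y (mul Y x y) = mul Y (dif Y x) y + ksign i (mul Y x (dif Y y))"
      unfolding dx dy unfolding ab(3) cd(3)
      using c A.leibniz[of a i c j] A.leibniz[of b "i - 1" c j] A.leibniz[of a i d "j - 1"] ab cd
      by (cases "even i"; simp add: mul_cone dif_cone carr neg twist
          A.A.parity_twist_hom[OF ab(1)] ksign_def A.act_minus_left A.act_minus_right bilinear
          A.act_diff_left A.act_diff_right A.A.dif_add A.A.dif_diff A.A.dif_minus A.A.diff_carr)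
        (simp_all add: A.A.scale_right_distrib A.A.scale_right_diff_distrib emul_add emul_minus
          emul_diff emul_scl algebra_simps)
  qed
qed

end

section \<open>Associator submodules of the cone\<close>

context chain_complex
begin

lemma carr_subcomplex:
  assumes "is_subcomplex C N"
  shows "carr (subcomplex C N) = N"
  using assms unfolding carr_def is_subcomplex_def subcomplex_def by simp

lemma is_complex_subcomplex:
  assumes "is_subcomplex C N"
  shows "is_complex (subcomplex C N)"
proof -
  have "module (scl C)" by (rule module_axioms)
  moreover have "subspace (N \<inter> gr C i)" for i
    using subcomplex_subspace[OF assms] gr_subspace by (rule subspace_inter)
  ultimately show ?thesis
    using subcomplex_carr[OF assms] subcomplex_dif[OF assms] gr_independent
    unfolding is_complex_def carr_subcomplex[OF assms]
    by (auto simp: subcomplex_def dif_add dif_scale dif_dif dif_gr)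
qed

end

text \<open>Makes a submodule a module in its own right, so that its own associator submodule can be
  compared with that of the ambient module.\<close>

lemma (in mdg_act) mdg_act_subcomplex:
  assumes "mdg_submodule A X act N"
  shows "mdg_act A (subcomplex X N) act"
proof -
  have N: "is_subcomplex X N" and act: "\<And>a x. a \<in> carr A \<Longrightarrow> x \<in> N \<Longrightarrow> act a x \<in> N"
    using assms unfolding mdg_submodule_def by blast+
  have "chain_action A (subcomplex X N) act"
    using X.subcomplex_carr[OF N] act A.gr_carr
    unfolding chain_action_def X.carr_subcomplex[OF N]
    by (auto simp: subcomplex_def act_add_left act_add_right act_scale_left act_scale_right
        act_gr leibniz)
  then show ?thesis
    by (intro mdg_act.intro chain_act.intro chain_act_axioms.intro chain_complex.intro)
      (simp_all add: X.is_complex_subcomplex[OF N] A.is_complex mul.chain_action)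
qed

section \<open>The action of \<open>F\<close> on a cone and the copy of \<open>F\<close> inside
  it\<close>

context cone_stage
begin

lemma base_act_action: "chain_action F A (base_act A)"
  unfolding chain_action_def base_act_def
  by (auto simp: emon_add emon_scl emon_dif emon_carr A.act_add_left A.act_add_right
      A.act_scale_left A.act_scale_right A.leibniz[OF emon_gr] F.A.gr_carr intro: A.act_gr emon_gr)

sublocale base: mdg_act F A "base_act A"
  by unfold_locales (rule base_act_action)

sublocale self: mdg_act A A "mul A" ..

text \<open>Restriction of scalars: the identity of \<open>A\<close> is compatible with the two
  actions along the inclusion of \<open>F\<close>.\<close>

lemma associator_base_le: "associator_submodule F A (base_act A) \<subseteq> associator_ideal A"
  using base.associator_submodule_image[OF self.mdg_act_axioms, of "emon {}" id]
  by (simp add: emon_carr emon_mul base_act_def)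

lemma mdg_module_base: "mdg_algebra F \<Longrightarrow> mdg_module F A (base_act A)"
  unfolding mdg_module_def
  by (simp add: A.A.is_complex base_act_action) (simp add: base_act_def one_A[symmetric] one_mul)

lemma mdg_submodule_base: "mdg_submodule F A (base_act A) (emon {} ` carr F)"
proof -
  have "is_subcomplex A (emon {} ` carr F)"
  proof (rule A.A.is_subcomplexI)
    show "A.A.subspace (emon {} ` carr F)"
    proof (rule A.A.subspaceI)
      show "0 \<in> emon {} ` carr F" using F.A.zero_carr emon_zero by (metis image_eqI)
    qed (auto simp: emon_add[symmetric] emon_scl[symmetric] intro: F.A.add_carr F.A.scale_carr)
  next
    fix J f i
    assume J: "finite J" "\<And>i. i \<in> J \<Longrightarrow> f i \<in> gr A i" "(\<Sum>i\<in>J. f i) \<in> emon {} ` carr F" "i \<in> J"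
    then obtain a where a: "a \<in> carr F" "(\<Sum>i\<in>J. f i) = emon {} a" by blast
    then obtain J' g where J': "finite J'" "\<And>i. i \<in> J' \<Longrightarrow> g i \<in> gr F i" "a = (\<Sum>i\<in>J'. g i)"
      using F.A.carr_sum by blast
    have "(\<Sum>i\<in>J'. emon {} (g i)) = emon {} (\<Sum>i\<in>J'. g i)"
      by (induction J' rule: infinite_finite_induct) (simp_all add: emon_zero emon_add)
    \<comment> \<open>By uniqueness the components of the image of \<open>a\<close> are the images
      of the components of \<open>a\<close>.\<close>
    then have "f i = (if i \<in> J' then emon {} (g i) else 0)"
      using A.A.sum_unique[of J f J' "\<lambda>i. emon {} (g i)" i] J a J' emon_gr by auto
    moreover have "0 \<in> emon {} ` carr F" using F.A.zero_carr emon_zero by (metis image_eqI)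
    ultimately show "f i \<in> emon {} ` carr F" using J' F.A.gr_carr by auto
  qed (auto simp: emon_carr emon_dif intro: F.A.dif_carr)
  then show ?thesis
    unfolding mdg_submodule_def by (auto simp: base_act_def emon_mul intro: F.act_carr)
qed

text \<open>The inclusion is an isomorphism onto its image, with inverse
  \<open>\<lambda>x. x {}\<close>; functoriality is applied in both directions. That the inverse
  preserves degrees is \<open>emon_gr_iff\<close>.\<close>

lemma associator_base_subcomplex:
  "associator_submodule F (subcomplex A (emon {} ` carr F)) (base_act A)
    = emon {} ` associator_ideal F"
proof
  let ?X = "emon {} ` carr F"
  interpret FF: mdg_act F F "mul F" ..
  interpret S: mdg_act F "subcomplex A ?X" "base_act A"
    by (rule base.mdg_act_subcomplex[OF mdg_submodule_base])
  have X: "is_subcomplex A ?X" using mdg_submodule_base unfolding mdg_submodule_def by blast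
  note carr = A.A.carr_subcomplex[OF X]
  have [simp]: "emon {} a {} = (a :: 'f)" for a by (simp add: emon_def)
  show "emon {} ` associator_ideal F \<subseteq> associator_submodule F (subcomplex A ?X) (base_act A)"
    by (rule FF.associator_submodule_image[OF S.mdg_act_axioms, of "\<lambda>a. a"])
      (auto simp: subcomplex_def emon_gr F.A.gr_carr emon_add emon_scl emon_dif base_act_def emon_mul)
  have "(\<lambda>x. x {}) ` associator_submodule F (subcomplex A ?X) (base_act A) \<subseteq> associator_ideal F"
    by (rule S.associator_submodule_image[OF FF.mdg_act_axioms, of "\<lambda>a. a"], unfold carr)
      (auto simp: subcomplex_def emon_gr_iff emon_scl[symmetric] emon_add[symmetric]
        emon_dif base_act_def emon_mul)
  moreover have "x = emon {} (x {})"
    if "x \<in> associator_submodule F (subcomplex A ?X) (base_act A)" for x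
  proof -
    have "x \<in> ?X"
      using that S.X.subcomplex_carr S.mdg_submodule_associator carr
      unfolding mdg_submodule_def by blast
    then show ?thesis by auto
  qed
  ultimately show "associator_submodule F (subcomplex A ?X) (base_act A) \<subseteq> emon {} ` associator_ideal F"
    by blast
qed

end

section \<open>Passing from \<open>A\<close> to \<open>A + e_k A\<close>: the two inclusions\<close>

context cone_step
begin

lemma mul_cone_left:
  "a \<in> carr A \<Longrightarrow> c \<in> carr A \<Longrightarrow> d \<in> carr A \<Longrightarrow>
    mul Y a (c + emul k d) = mul A a c + emul k (mul A (parity_twist A a) d)"
  using mul_cone[of a 0 c d] by (simp add: A.A.zero_carr emul_zero A.act_zero_left)

lemma mul_cone_fst: "a \<in> carr A \<Longrightarrow> c \<in> carr A \<Longrightarrow> mul Y a c = mul A a c"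
  using mul_cone_left[of a c 0]
  by (simp add: A.A.zero_carr emul_zero A.act_zero_right A.A.parity_twist_carr)

lemma mul_cone_snd:
  "a \<in> carr A \<Longrightarrow> d \<in> carr A \<Longrightarrow> mul Y a (emul k d) = emul k (mul A (parity_twist A a) d)"
  using mul_cone_left[of a 0 d] by (simp add: A.A.zero_carr A.act_zero_right)

lemma dif_cone_fst: "a \<in> carr A \<Longrightarrow> dif Y a = dif A a"
  using dif_cone[of a 0] by (simp add: A.A.zero_carr emul_zero)

lemma dif_cone_snd: "b \<in> carr A \<Longrightarrow> dif Y (emul k b) = scl A r b - emul k (dif A b)"
  using dif_cone[of 0 b] by (simp add: A.A.zero_carr)

text \<open>The bound on the variables rises to \<open>Suc k\<close> since \<open>e_k\<close> now
  occurs; on elements without \<open>e_k\<close> the cone operations restrict to those of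
  \<open>A\<close>, so the conditions on the copy of \<open>F\<close> persist.\<close>

lemma cone_stage_cone: "cone_stage F Y (Suc k)"
proof unfold_locales
  show "chain_action Y Y (mul Y)" by (rule chain_action_cone)
  show "one F \<in> gr F 0" by (rule one_F)
  show "scl Y = (\<lambda>r x S. scl F r (x S))" by (simp add: cone_simps scl_A)
  show "S \<subseteq> {..<Suc k}" if "x \<in> carr Y" "x S \<noteq> 0" for x S
  proof -
    obtain a b where *: "a \<in> carr A" "b \<in> carr A" "x = a + emul k b"
      using \<open>x \<in> carr Y\<close> unfolding carr_cone by (rule cone_sumE)
    then have "a S \<noteq> 0 \<or> k \<in> S \<and> b (S - {k}) \<noteq> 0"
      using \<open>x S \<noteq> 0\<close> by (auto simp: fun_arith emul_def split: if_splits)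
    then show ?thesis using support[OF *(1)] support[OF *(2)] by fastforce
  qed
  show "emon {} a \<in> gr Y i" if "a \<in> gr F i" for a i using that by (intro gr_pair_left emon_gr)
  show "a \<in> gr F i" if "a \<in> carr F" "emon {} a \<in> gr Y i" for a i
    using that gr_cone_fst[of "emon {} a" i] cone_fst_pair[of "emon {} a" 0]
    by (simp add: emon_carr emul_zero emon_gr_iff)
  show "mul Y (emon {} a) (emon {} b) = emon {} (mul F a b)" if "a \<in> carr F" "b \<in> carr F" for a b
    using that by (simp add: mul_cone_fst emon_carr emon_mul)
  show "dif Y (emon {} a) = emon {} (dif F a)" if "a \<in> carr F" for a
    using that by (simp add: dif_cone_fst emon_carr emon_dif)
  show "one Y = emon {} (one F)" by (simp add: cone_simps one_A)
  show "mul Y (one Y) x = x" if "x \<in> carr Y" for x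
  proof -
    obtain a b where *: "a \<in> carr A" "b \<in> carr A" "x = a + emul k b"
      using \<open>x \<in> carr Y\<close> unfolding carr_cone by (rule cone_sumE)
    \<comment> \<open>In degree 0 the unit equals its own twist, so it also acts as the identity on
      the coefficient of \<open>e_k\<close>.\<close>
    have "one A \<in> gr A 0" using emon_gr one_F one_A by simp
    then show ?thesis
      using * A.A.gr_carr A.A.parity_twist_hom[of "one A" 0]
      by (simp add: cone_simps mul_cone_left one_mul ksign_def)
  qed
qed

sublocale cone: cone_stage F Y "Suc k"
  by (rule cone_stage_cone)

text \<open>Gradedness is read off coordinate by coordinate. For the differential,
  \<open>d(a + e_k b)\<close> has coordinates \<open>d(a) + rb\<close> and \<open>- d(b)\<close>,
  both in \<open>N\<close>.\<close>

lemma is_subcomplex_cone_sum: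
  assumes N: "is_subcomplex A N"
  shows "is_subcomplex Y (cone_sum k N N)"
proof (rule Y.is_subcomplexI)
  note sub = A.A.subcomplex_subspace[OF N] and c = A.A.subcomplex_carr[OF N]
  show "cone_sum k N N \<subseteq> carr Y"
    unfolding carr_cone using c by (auto elim!: cone_sumE intro: cone_sumI)
  show "Y.subspace (cone_sum k N N)"
    using subspace_cone_sum[OF sub sub] by (simp add: cone_simps)
  show "f i \<in> cone_sum k N N"
    if J: "finite J" "\<And>i. i \<in> J \<Longrightarrow> f i \<in> gr Y i" "(\<Sum>i\<in>J. f i) \<in> cone_sum k N N" "i \<in> J" for J f i
  proof -
    obtain a b where *: "a \<in> N" "b \<in> N" "(\<Sum>i\<in>J. f i) = a + emul k b"
      using J(3) by (rule cone_sumE)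
    then have "cone_fst k (\<Sum>i\<in>J. f i) \<in> N" "cone_snd k (\<Sum>i\<in>J. f i) \<in> N"
      using c by simp_all
    then have "cone_fst k (f i) \<in> N" "cone_snd k (f i) \<in> N"
      using A.A.subcomplex_component[OF N, of J "\<lambda>i. cone_fst k (f i)" i] gr_cone_fst
        A.A.subcomplex_component_shift[OF N, of J "\<lambda>i. cone_snd k (f i)" "-1" i] gr_cone_snd J
      by (auto simp: cone_fst_sum cone_snd_sum)
    then show ?thesis using gr_cone_eq[OF J(2)[OF J(4)]] cone_sumI by metis
  qed
  show "dif Y x \<in> cone_sum k N N" if "x \<in> cone_sum k N N" for x
  proof -
    obtain a b where *: "a \<in> N" "b \<in> N" "x = a + emul k b"
      using \<open>x \<in> cone_sum k N N\<close> by (rule cone_sumE)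
    have "dif Y x = (dif A a + scl A r b) + emul k (- dif A b)"
      using * c by (simp add: dif_cone emul_minus)
    then show ?thesis
      using * A.A.subcomplex_dif[OF N] sub
      by (auto intro!: cone_sumI A.A.subspace_add A.A.subspace_scale A.A.subspace_neg)
  qed
qed

text \<open>The right side is an ideal: with \<sigma> the twist, the product of
  \<open>a + e_k b\<close> and \<open>u + e_k v\<close> has coordinates \<open>a u\<close> and
  \<open>b u + \<sigma>(a) v\<close>, and every term has a factor in the associator ideal of
  \<open>A\<close>.\<close>

lemma associator_ideal_cone_le:
  "associator_ideal Y \<subseteq> cone_sum k (associator_ideal A) (associator_ideal A)"
proof (rule cone.A.associator_submodule_least)
  let ?N = "associator_ideal A"
  have N: "is_subcomplex A ?N" and act: "\<And>a x. a \<in> carr A \<Longrightarrow> x \<in> ?N \<Longrightarrow> mul A a x \<in> ?N"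
    using self.mdg_submodule_associator unfolding mdg_submodule_def by blast+
  note sub = A.A.subcomplex_subspace[OF N] and c = A.A.subcomplex_carr[OF N]
  have "mul Y x y \<in> cone_sum k ?N ?N" if "x \<in> carr Y" "y \<in> cone_sum k ?N ?N" for x y
  proof -
    obtain a b where ab: "a \<in> carr A" "b \<in> carr A" "x = a + emul k b"
      using \<open>x \<in> carr Y\<close> unfolding carr_cone by (rule cone_sumE)
    obtain u v where uv: "u \<in> ?N" "v \<in> ?N" "y = u + emul k v"
      using \<open>y \<in> cone_sum k ?N ?N\<close> by (rule cone_sumE)
    show ?thesis
      unfolding ab(3) uv(3) using ab(1,2) uv(1,2) c
      by (auto simp: mul_cone intro!: cone_sumI A.A.subspace_add[OF sub] act A.A.parity_twist_carr)
  qed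
  then show "mdg_submodule Y Y (mul Y) (cone_sum k ?N ?N)"
    unfolding mdg_submodule_def using is_subcomplex_cone_sum[OF N] by blast
  show "mul Y (mul Y x y) z - mul Y x (mul Y y z) \<in> cone_sum k ?N ?N"
    if xyz: "x \<in> carr Y" "y \<in> carr Y" "z \<in> carr Y" for x y z
  proof -
    obtain a b where *: "a \<in> carr A" "b \<in> carr A" "x = a + emul k b"
      using xyz(1) unfolding carr_cone by (rule cone_sumE)
    obtain c d where **: "c \<in> carr A" "d \<in> carr A" "y = c + emul k d"
      using xyz(2) unfolding carr_cone by (rule cone_sumE)
    obtain u v where ***: "u \<in> carr A" "v \<in> carr A" "z = u + emul k v"
      using xyz(3) unfolding carr_cone by (rule cone_sumE)
    let ?\<sigma> = "parity_twist A"
    let ?as = "\<lambda>a b c. mul A (mul A a b) c - mul A a (mul A b c)"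
    have mem: "?as a b c \<in> ?N" if "a \<in> carr A" "b \<in> carr A" "c \<in> carr A" for a b c
      using that by (rule self.associator_mem)
    \<comment> \<open>The last associator arises because the twist of \<open>a c\<close> is
      \<sigma>(a) \<sigma>(c), by multiplicativity of the twist.\<close>
    have "mul Y (mul Y x y) z - mul Y x (mul Y y z)
        = ?as a c u + emul k (?as b c u + ?as (?\<sigma> a) d u + ?as (?\<sigma> a) (?\<sigma> c) v)"
      unfolding *(3) **(3) ***(3) using *(1,2) **(1,2) ***(1,2)
      by (simp add: mul_cone A.A.add_carr A.act_carr A.A.parity_twist_carr A.parity_twist_act
          A.act_add_left A.act_add_right)
        (simp add: emul_add emul_diff algebra_simps)
    also have "\<dots> \<in> cone_sum k ?N ?N"
      using * ** *** by (intro cone_sumI A.A.subspace_add[OF sub] mem A.A.parity_twist_carr)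
    finally show ?thesis .
  qed
qed

lemma associator_base_cone_ge:
  "cone_sum k (associator_submodule F A (base_act A)) (associator_submodule F A (base_act A))
    \<subseteq> associator_submodule F Y (base_act Y)"
proof -
  let ?N = "associator_submodule F Y (base_act Y)"
  let ?M = "{n \<in> carr A. n \<in> ?N \<and> emul k n \<in> ?N}"
  have N: "is_subcomplex Y ?N" and act: "\<And>a x. a \<in> carr F \<Longrightarrow> x \<in> ?N \<Longrightarrow> base_act Y a x \<in> ?N"
    using cone.base.mdg_submodule_associator unfolding mdg_submodule_def by blast+
  have sub: "A.A.subspace ?N" using Y.subcomplex_subspace[OF N] by (simp add: cone_simps)
  have fst: "base_act Y a n = base_act A a n" if "a \<in> carr F" "n \<in> carr A" for a n
    using that by (simp add: base_act_def mul_cone_fst emon_carr)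
  \<comment> \<open>Moving \<open>e_k\<close> past a scalar twists it; as the twist is an
    involution, the twist can be placed on the right-hand side.\<close>
  have snd: "emul k (base_act A a n) = base_act Y (parity_twist F a) (emul k n)"
    if "a \<in> carr F" "n \<in> carr A" for a n
    using that by (simp add: base_act_def mul_cone_snd emon_carr F.A.parity_twist_carr
        emon_parity_twist F.A.parity_twist_twist)
  have carr: "n \<in> carr Y" "emul k n \<in> carr Y" if "n \<in> carr A" for n
    using cone_sumI[OF that A.A.zero_carr, of k] cone_sumI[OF A.A.zero_carr that, of k]
    by (simp_all add: carr_cone emul_zero)
  have "associator_submodule F A (base_act A) \<subseteq> ?M"
  proof (rule base.associator_submodule_least)
    have "is_subcomplex A ?M"
    proof (rule A.A.is_subcomplexI)
      show "A.A.subspace ?M"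
        by (rule A.A.subspaceI)
          (auto simp: emul_zero emul_add emul_scl A.A.zero_carr intro: A.A.add_carr A.A.scale_carr
            A.A.subspace_0[OF sub] A.A.subspace_add[OF sub] A.A.subspace_scale[OF sub])
      show "f i \<in> ?M" if J: "finite J" "\<And>i. i \<in> J \<Longrightarrow> f i \<in> gr A i" "(\<Sum>i\<in>J. f i) \<in> ?M" "i \<in> J"
        for J f i
      proof -
        have "f i \<in> carr A" using A.A.gr_carr J by blast
        then show ?thesis
          using Y.subcomplex_component[OF N, of J f i] gr_pair_left
            Y.subcomplex_component_shift[OF N, of J "\<lambda>i. emul k (f i)" 1 i] gr_pair_right
            J by (auto simp: emul_sum)
      qed
      show "dif A x \<in> ?M" if "x \<in> ?M" for x
      proof -
        have x: "x \<in> carr A" "x \<in> ?N" "emul k x \<in> ?N" using that by auto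
        \<comment> \<open>The formula for \<open>d(e_k x)\<close> solved for
          \<open>e_k d(x)\<close>: closure under the differential uses that both \<open>x\<close>
          and \<open>e_k x\<close> lie in \<open>?N\<close>.\<close>
        have "emul k (dif A x) = scl A r x - dif Y (emul k x)"
          using x by (simp add: dif_cone_snd)
        then have "emul k (dif A x) \<in> ?N"
          using x Y.subcomplex_dif[OF N]
          by (auto intro: A.A.subspace_diff[OF sub] A.A.subspace_scale[OF sub])
        then show ?thesis using x Y.subcomplex_dif[OF N x(2)] by (simp add: dif_cone_fst A.A.dif_carr)
      qed
    qed auto
    moreover have "base_act A a n \<in> ?M" if "a \<in> carr F" "n \<in> ?M" for a n
      using that act[of a n] act[of "parity_twist F a" "emul k n"]
      by (auto simp: fst snd base.act_carr F.A.parity_twist_carr)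
    ultimately show "mdg_submodule F A (base_act A) ?M" unfolding mdg_submodule_def by blast
    \<comment> \<open>Besides \<open>[a, b, x]\<close> itself, its product with \<open>e_k\<close>
      is an associator of the cone, namely \<open>[\<sigma>a, \<sigma>b, e_k x]\<close>.\<close>
    show "base_act A (mul F a b) x - base_act A a (base_act A b x) \<in> ?M"
      if "a \<in> carr F" "b \<in> carr F" "x \<in> carr A" for a b x
      using that cone.base.associator_mem[of a b x]
        cone.base.associator_mem[of "parity_twist F a" "parity_twist F b" "emul k x"]
      by (auto simp: fst snd emul_diff base.act_carr F.A.parity_twist_carr F.act_carr
          F.parity_twist_act carr intro: A.A.diff_carr)
  qed
  then show ?thesis by (auto elim!: cone_sumE intro!: A.A.subspace_add[OF sub])
qed

end

section \<open>Submodules spanned by the exterior monomials\<close>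

lemma emon_sum_apply:
  "finite M \<Longrightarrow> (\<Sum>T\<in>M. emon T (x T)) S = (if S \<in> M then x S else 0 :: 'f::ab_group_add)"
  by (induction M rule: finite_induct) (auto simp: fun_arith emon_def)

text \<open>The coefficients of a sum of monomials are its values. Outside the subsets of
  \<open>{..<m}\<close> they vanish, and \<open>0 \<in> N\<close> allows the condition on
  coefficients to be stated for all \<open>S\<close>.\<close>

lemma e_span_eq:
  assumes "0 \<in> N"
  shows "e_span m N = {x. (\<forall>S. x S \<in> N) \<and> (\<forall>S. x S \<noteq> 0 \<longrightarrow> S \<subseteq> {..<m})}" (is "_ = ?R")
proof
  show "e_span m N \<subseteq> ?R"
  proof
    fix y assume "y \<in> e_span m N"
    then obtain x where x: "y = (\<Sum>S\<in>Pow {..<m}. emon S (x S))" "\<forall>S\<in>Pow {..<m}. x S \<in> N"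
      unfolding e_span_def by blast
    then have "y S = (if S \<subseteq> {..<m} then x S else 0)" for S
      by (simp add: emon_sum_apply)
    then show "y \<in> ?R" using x(2) assms by auto
  qed
  show "?R \<subseteq> e_span m N"
  proof
    fix x assume x: "x \<in> ?R"
    have "x S = (\<Sum>S\<in>Pow {..<m}. emon S (x S)) S" for S
      using x by (auto simp: emon_sum_apply)
    then have "x = (\<Sum>S\<in>Pow {..<m}. emon S (x S))" by blast
    then show "x \<in> e_span m N" unfolding e_span_def using x by blast
  qed
qed

lemma e_span_0: "e_span 0 N = emon {} ` N"
  by (auto simp: e_span_def)

text \<open>Subsets of \<open>{..<Suc k}\<close> either avoid \<open>k\<close> or arise from a
  subset of \<open>{..<k}\<close> by inserting it; these two kinds give \<open>cone_fst\<close> and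
  \<open>cone_snd\<close>.\<close>

lemma e_span_Suc:
  assumes N: "0 \<in> N" "\<And>a b. a \<in> N \<Longrightarrow> b \<in> N \<Longrightarrow> a + b \<in> N"
  shows "e_span (Suc k) N = cone_sum k (e_span k N) (e_span k N)"
proof
  show "cone_sum k (e_span k N) (e_span k N) \<subseteq> e_span (Suc k) N"
  proof
    fix x assume "x \<in> cone_sum k (e_span k N) (e_span k N)"
    then obtain a b where ab: "\<forall>S. a S \<in> N" "\<forall>S. a S \<noteq> 0 \<longrightarrow> S \<subseteq> {..<k}"
        "\<forall>S. b S \<in> N" "\<forall>S. b S \<noteq> 0 \<longrightarrow> S \<subseteq> {..<k}" and x: "x = a + emul k b"
      by (auto simp: e_span_eq[OF N(1)] elim!: cone_sumE)
    have "S \<subseteq> {..<Suc k}" if "x S \<noteq> 0" for S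
    proof -
      have "a S \<noteq> 0 \<or> k \<in> S \<and> b (S - {k}) \<noteq> 0"
        using that x by (auto simp: fun_arith emul_def split: if_splits)
      then show ?thesis using ab by fastforce
    qed
    moreover have "x S \<in> N" for S using ab N by (auto simp: x fun_arith emul_def)
    ultimately show "x \<in> e_span (Suc k) N" by (simp add: e_span_eq[OF N(1)])
  qed
  show "e_span (Suc k) N \<subseteq> cone_sum k (e_span k N) (e_span k N)"
  proof
    fix x assume "x \<in> e_span (Suc k) N"
    then have x: "\<And>S. x S \<in> N" "\<And>S. x S \<noteq> 0 \<Longrightarrow> S \<subseteq> {..<Suc k}"
      by (auto simp: e_span_eq[OF N(1)])
    have "cone_fst k x \<in> e_span k N"
      using x N(1) by (fastforce simp: e_span_eq[OF N(1)] cone_fst_def less_Suc_eq)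
    moreover have "cone_snd k x \<in> e_span k N"
      using x N(1) by (fastforce simp: e_span_eq[OF N(1)] cone_snd_def less_Suc_eq)
    moreover have "x = cone_fst k x + emul k (cone_snd k x)"
      by (auto simp: fun_eq_iff fun_arith cone_fst_def cone_snd_def emul_def insert_absorb)
    ultimately show "x \<in> cone_sum k (e_span k N) (e_span k N)" using cone_sumI by metis
  qed
qed

section \<open>The iterated cone\<close>

lemma cone_base_simps:
  "scl (cone_base F) = (\<lambda>r x S. scl F r (x S))"
  "gr (cone_base F) i = emon {} ` gr F i"
  "dif (cone_base F) x = emon {} (dif F (x {}))"
  "mul (cone_base F) x y = emon {} (mul F (x {}) (y {}))"
  "one (cone_base F) = emon {} (one F)"
  by (simp_all add: cone_base_def)

lemma emon_empty_apply: "emon {} a {} = a"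
  by (simp add: emon_def)

text \<open>The start of the iteration: all structure is transported along \<open>emon {}\<close>,
  whose inverse is evaluation at \<open>{}\<close>, and only the empty monomial occurs.\<close>

lemma cone_stage_base:
  assumes "mdg_algebra F"
  shows "cone_stage F (cone_base F) 0"
proof -
  let ?B = "cone_base F" and ?\<iota> = "emon {} :: 'b \<Rightarrow> nat set \<Rightarrow> 'b"
  interpret F: chain_act F F "mul F"
    using assms unfolding mdg_algebra_def by unfold_locales auto
  have add: "?\<iota> (a + b) = ?\<iota> a + ?\<iota> b" for a b by (auto simp: emon_def fun_arith)
  have minus: "?\<iota> (- a) = - ?\<iota> a" for a by (auto simp: emon_def fun_arith)
  have zero: "?\<iota> 0 = 0" by (auto simp: emon_def fun_arith)
  have scale: "?\<iota> (scl F r a) = scl ?B r (?\<iota> a)" for r a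
    by (auto simp: emon_def cone_base_simps)
  interpret B: module "scl ?B"
    by unfold_locales (auto simp: cone_base_simps fun_arith F.A.scale_left_distrib
        F.A.scale_right_distrib)
  have sub: "B.subspace (?\<iota> ` V)" if "F.A.subspace V" for V
  proof (rule B.subspaceI)
    show "0 \<in> ?\<iota> ` V" using F.A.subspace_0[OF that] zero by (metis image_eqI)
  qed (auto simp: add[symmetric] scale[symmetric] F.A.subspace_add[OF that]
      F.A.subspace_scale[OF that])
  have carr: "carr ?B = ?\<iota> ` carr F"
  proof
    show "carr ?B \<subseteq> ?\<iota> ` carr F"
      unfolding carr_def[of ?B]
      by (rule B.span_minimal)
        (auto simp: cone_base_simps(2) F.A.gr_carr intro: sub F.A.carr_subspace)
    have "?\<iota> a \<in> carr ?B" if "a \<in> carr F" for a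
      using that unfolding carr_def[of ?B]
    proof (induction rule: F.A.carr_induct)
      case (hom i a)
      then show ?case by (intro B.span_base) (auto simp: cone_base_simps)
    qed (auto simp: zero add B.span_zero intro: B.span_add)
    then show "?\<iota> ` carr F \<subseteq> carr ?B" by blast
  qed
  have "is_complex ?B"
  proof (unfold is_complex_def, intro conjI allI impI ballI)
    show "module (scl ?B)" by (rule B.module_axioms)
    show "B.subspace (gr ?B i)" for i
      unfolding cone_base_simps(2) by (rule sub[OF F.A.gr_subspace])
    show "f i = 0" if "finite J" "\<forall>i\<in>J. f i \<in> gr ?B i" "(\<Sum>i\<in>J. f i) = 0" "i \<in> J" for J f i
    proof -
      \<comment> \<open>Evaluation at \<open>{}\<close> is additive, so a relation in the base
        becomes one between elements of \<open>F\<close>.\<close>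
      have "(\<Sum>i\<in>J. f i {}) = (\<Sum>i\<in>J. f i) {}"
        using \<open>finite J\<close> by (induction J rule: finite_induct) (auto simp: fun_arith)
      moreover have "f i {} \<in> gr F i" if "i \<in> J" for i
        using \<open>\<forall>i\<in>J. f i \<in> gr ?B i\<close> that by (auto simp: cone_base_simps emon_empty_apply)
      ultimately have "f i {} = 0"
        using F.A.gr_independent[of J "\<lambda>i. f i {}" i] that by (simp add: fun_arith)
      then show ?thesis using that zero by (auto simp: cone_base_simps emon_empty_apply)
    qed
  qed (auto simp: carr cone_base_simps(2,3) emon_empty_apply add[symmetric] scale[symmetric]
      F.A.dif_add F.A.dif_scale F.A.dif_dif zero intro: F.A.dif_gr)
  moreover have "chain_action ?B ?B (mul ?B)"
    unfolding chain_action_def carr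
    by (auto simp: cone_base_simps(2,3,4) emon_empty_apply add[symmetric] scale[symmetric]
        F.A.gr_carr F.act_add_left F.act_add_right F.act_scale_left F.act_scale_right
        F.leibniz ksign_def minus[symmetric] intro: F.act_gr)
  ultimately interpret act: chain_act ?B ?B "mul ?B" by unfold_locales
  have one: "one F \<in> gr F 0" "\<And>a. a \<in> carr F \<Longrightarrow> mul F (one F) a = a"
    using assms unfolding mdg_algebra_def by blast+
  show ?thesis
  proof unfold_locales
    show "S \<subseteq> {..<0::nat}" if "x \<in> carr ?B" "x S \<noteq> 0" for x S
      using that unfolding carr by (auto simp: emon_def split: if_splits)
    show "a \<in> gr F i" if "?\<iota> a \<in> gr ?B i" for a i
      using that unfolding cone_base_simps(2) by (metis emon_empty_apply imageE)
    show "mul ?B (one ?B) x = x" if "x \<in> carr ?B" for x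
      using that one(2) unfolding carr cone_base_simps(4,5) by (auto simp: emon_empty_apply)
  qed (simp_all add: one(1) cone_base_simps emon_empty_apply)
qed

lemma cone_stage_tower: "mdg_algebra F \<Longrightarrow> cone_stage F (cone_tower F rs k) k"
proof (induction k)
  case 0
  then show ?case using cone_stage_base by simp
next
  case (Suc k)
  then interpret cone_step F "cone_tower F rs k" k "rs ! k"
    by (simp add: cone_step_def)
  show ?case using cone_stage_cone by simp
qed

text \<open>Induction on the number of variables: each one-step inclusion combines with the
  induction hypothesis because \<open>V + e_k V\<close> is monotone in \<open>V\<close>, and
  \<open>e_span\<close> satisfies the same recursion.\<close>

lemma associator_tower:
  assumes "mdg_algebra F"
  defines "N \<equiv> associator_ideal F"
  shows "e_span k N \<subseteq> associator_submodule F (cone_tower F rs k) (base_act (cone_tower F rs k))"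
    and "associator_ideal (cone_tower F rs k) \<subseteq> e_span k N"
proof -
  interpret FF: chain_act F F "mul F"
    using assms(1) unfolding mdg_algebra_def by unfold_locales auto
  interpret FF: mdg_act F F "mul F" ..
  have N: "is_subcomplex F N"
    using FF.mdg_submodule_associator unfolding mdg_submodule_def N_def by blast
  note sub = FF.A.subcomplex_subspace[OF N]
  have Suc: "e_span (Suc k) N = cone_sum k (e_span k N) (e_span k N)" for k
    using FF.A.subspace_0[OF sub] FF.A.subspace_add[OF sub] by (rule e_span_Suc)
  have "e_span k N \<subseteq> associator_submodule F (cone_tower F rs k) (base_act (cone_tower F rs k)) \<and>
    associator_ideal (cone_tower F rs k) \<subseteq> e_span k N"
  proof (induction k)
    case 0
    let ?B = "cone_base F"
    interpret B: cone_stage F ?B 0 using assms(1) by (rule cone_stage_base)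
    have carr: "x \<in> emon {} ` carr F" if "x \<in> carr ?B" for x
      using that
    proof (induction rule: B.A.A.carr_induct)
      case zero
      then show ?case using B.emon_zero FF.A.zero_carr by (metis image_eqI)
    qed (auto simp: cone_base_simps FF.A.gr_carr B.emon_add[symmetric] intro: FF.A.add_carr)
    \<comment> \<open>With no variables adjoined, evaluation at \<open>{}\<close> is compatible with
      all operations, so it maps associators to associators.\<close>
    have "(\<lambda>x. x {}) ` associator_ideal ?B \<subseteq> N"
      unfolding N_def
      by (rule B.self.associator_submodule_image[OF FF.mdg_act_axioms, of "\<lambda>x. x {}"])
        (auto dest!: carr simp: cone_base_simps emon_empty_apply fun_arith)
    moreover have "x = emon {} (x {})" if "x \<in> associator_ideal ?B" for x
      using B.A.A.subcomplex_carr B.self.mdg_submodule_associator that carr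
      unfolding mdg_submodule_def by (metis emon_empty_apply imageE)
    ultimately have "associator_ideal ?B \<subseteq> emon {} ` N" by blast
    moreover have "emon {} ` N \<subseteq> associator_submodule F ?B (base_act ?B)"
      unfolding N_def
      by (rule FF.associator_submodule_image[OF B.base.mdg_act_axioms, of "\<lambda>a. a"])
        (auto simp: B.emon_gr B.emon_add B.emon_scl B.emon_dif base_act_def B.emon_mul)
    ultimately show ?case by (simp add: e_span_0)
  next
    case (Suc k)
    interpret cone_step F "cone_tower F rs k" k "rs ! k"
      using cone_stage_tower[OF assms(1)] by (simp add: cone_step_def)
    have mono: "cone_sum k V V \<subseteq> cone_sum k W W" if "V \<subseteq> W" for V W :: "(nat set \<Rightarrow> 'b) set"
      using that unfolding cone_sum_def by blast
    show ?case
      using Suc.IH associator_ideal_cone_le associator_base_cone_ge mono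
      unfolding \<open>\<And>k. e_span (Suc k) N = _\<close> by (simp) (meson order_trans)
  qed
  then show "e_span k N \<subseteq> associator_submodule F (cone_tower F rs k) (base_act (cone_tower F rs k))"
    "associator_ideal (cone_tower F rs k) \<subseteq> e_span k N" by auto
qed

text \<open>Restriction of scalars closes the chain of inclusions: the \<open>F\<close>-submodule
  lies in the ideal, the ideal in the span, and the span in the \<open>F\<close>-submodule.\<close>

lemma associator_iterated_cone:
  fixes F :: "('r::comm_ring_1, 'f::ab_group_add) mdg" and rs :: "'r list"
  assumes F: "mdg_algebra F"
  defines "Y \<equiv> iterated_cone F rs"
  shows "associator_submodule F Y (base_act Y) = e_span (length rs) (associator_ideal F)"
    and "e_span (length rs) (associator_ideal F) = associator_ideal Y"
    and "associative_extension F Y (base_act Y) (emon {} ` carr F)"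
proof -
  interpret Y: cone_stage F Y "length rs"
    unfolding Y_def iterated_cone_def using F by (rule cone_stage_tower)
  interpret FF: mdg_act F F "mul F" ..
  let ?E = "e_span (length rs) (associator_ideal F)"
  have E: "?E \<subseteq> associator_submodule F Y (base_act Y)" "associator_ideal Y \<subseteq> ?E"
    unfolding Y_def iterated_cone_def using associator_tower[OF F] by blast+
  then show eq: "associator_submodule F Y (base_act Y) = ?E" and "?E = associator_ideal Y"
    using Y.associator_base_le by blast+
  have N: "is_subcomplex F (associator_ideal F)"
    using FF.mdg_submodule_associator unfolding mdg_submodule_def by blast
  note 0 = Y.F.A.subspace_0[OF Y.F.A.subcomplex_subspace[OF N]]
  \<comment> \<open>The coefficient of \<open>emon {} a\<close> at \<open>{}\<close> is
    \<open>a\<close>, so membership in \<open>?E\<close> forces \<open>a\<close> into the associator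
    ideal of \<open>F\<close>.\<close>
  have "emon {} ` associator_ideal F = emon {} ` carr F \<inter> ?E"
    using Y.F.A.subcomplex_carr[OF N] 0
    by (auto simp: e_span_eq[OF 0] emon_def split: if_splits)
  then show "associative_extension F Y (base_act Y) (emon {} ` carr F)"
    unfolding associative_extension_def Y.associator_base_subcomplex eq
    using Y.mdg_module_base[OF F] Y.mdg_submodule_base by simp
qed

theorem theorem4p2:
  fixes \<mm> I :: "'r::comm_ring_1 set"
    and F :: "('r, 'f::ab_group_add) mdg"
  assumes "local_ring_with \<mm>"
    and "is_ideal I" and "I \<subseteq> \<mm>"
    and "minimal_free_resolution \<mm> I F"
    and "mdg_algebra F"
  shows
    "(\<forall>r\<in>\<mm>. quot_regular I r \<longrightarrow>
       (let Y = mapping_cone 0 r (cone_base F) in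
          associator_submodule F Y (base_act Y)
            = {emon {} x + emon {0} y | x y. x \<in> associator_ideal F \<and> y \<in> associator_ideal F} \<and>
          {emon {} x + emon {0} y | x y. x \<in> associator_ideal F \<and> y \<in> associator_ideal F}
            = associator_ideal Y \<and>
          associative_extension F Y (base_act Y) (emon {} ` carr F))) \<and>
     (\<forall>rs. maximal_quot_regular_seq \<mm> I rs \<longrightarrow>
       (let Y = iterated_cone F rs in
          associator_submodule F Y (base_act Y) = e_span (length rs) (associator_ideal F) \<and>
          e_span (length rs) (associator_ideal F) = associator_ideal Y \<and>
          associative_extension F Y (base_act Y) (emon {} ` carr F)))"
proof -
  \<comment> \<open>A single cone is the tower of a one-element list, so one result covers both
    halves of the statement.\<close>
  have single: "mapping_cone 0 r (cone_base F) = iterated_cone F [r]" for r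
    by (simp add: iterated_cone_def)
  have e_span_1: "{emon {} x + emon {0} y | x y. x \<in> N \<and> y \<in> N} = e_span (Suc 0) N"
    for N :: "'f set"
  proof -
    have Pow: "Pow {..<Suc 0} = {{}, {0::nat}}" by (auto simp: lessThan_Suc)
    \<comment> \<open>The two coefficients are packed into one function on the subsets of
      \<open>{0}\<close>, as \<open>e_span\<close> requires.\<close>
    have "\<exists>z. emon {} x + emon {0} y = emon {} (z {}) + emon {0::nat} (z {0}) \<and> z {} \<in> N \<and> z {0} \<in> N"
      if "x \<in> N" "y \<in> N" for x y
      using that by (intro exI[of _ "\<lambda>S. if S = {} then x else y"]) simp
    then show ?thesis unfolding e_span_def Pow by auto
  qed
  note cone = associator_iterated_cone[OF assms(5)]
  show ?thesis
    unfolding single Let_def e_span_1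
    using cone[of "[r]" for r] cone by (metis length_Cons list.size(3))
qed

end
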